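(* For every integer $n\geq 1$, the middle layer graph $Q_{2n+1}(n,n+1)$ has at least $\frac{1}{4}\,2^{2^{\lfloor (n+1)/4\rfloor}}$ different Hamilton cycles.
   Context: For $m\geq 1$ and $0\leq k\leq m$, let $B_m(k)$ denote the set of bitstrings of length $m$ with exactly $k$ entries equal to $1$. The middle layer graph $Q_{2n+1}(n,n+1)$ is the graph with vertex set $B_{2n+1}(n)\cup B_{2n+1}(n+1)$, in which two vertices are adjacent if and only if the corresponding bitstrings differ in exactly one bit. Two Hamilton cycles are different if they are different subgraphs (different edge sets). *)

theory Defs
  imports Complex_Main
begin

definition bitstrings :: "nat \<Rightarrow> nat \<Rightarrow> bool list set" where
  "bitstrings m k = {x. length x = m \<and> count_list x True = k}"

definition differ_in_one_bit :: "bool list \<Rightarrow> bool list \<Rightarrow> bool" where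
  "differ_in_one_bit x y \<longleftrightarrow>
     length x = length y \<and> card {i. i < length x \<and> x ! i \<noteq> y ! i} = 1"

text \<open>A simple undirected graph is given by its vertex set and its edge set, the edges being
  two-element sets of vertices.\<close>

definition middle_layer_verts :: "nat \<Rightarrow> bool list set" where
  "middle_layer_verts n = bitstrings (2 * n + 1) n \<union> bitstrings (2 * n + 1) (n + 1)"

definition middle_layer_edges :: "nat \<Rightarrow> bool list set set" where
  "middle_layer_edges n =
     {{x, y} | x y. x \<in> middle_layer_verts n \<and> y \<in> middle_layer_verts n \<and> differ_in_one_bit x y}"

definition closed_walk_edges :: "'a list \<Rightarrow> 'a set set" where
  "closed_walk_edges vs = {{vs ! i, vs ! ((i + 1) mod length vs)} | i. i < length vs}"

text \<open>A Hamilton cycle is a spanning subgraph, hence determined by its edge set. Representing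
  it by that set identifies the vertex sequences that differ only in starting point or
  direction. The length condition excludes traversing a single edge back and forth.\<close>

definition hamilton_cycle :: "'a set \<Rightarrow> 'a set set \<Rightarrow> 'a set set \<Rightarrow> bool" where
  "hamilton_cycle V E C \<longleftrightarrow>
     (\<exists>vs. distinct vs \<and> set vs = V \<and> length vs \<ge> 3 \<and>
           closed_walk_edges vs \<subseteq> E \<and> C = closed_walk_edges vs)"

end

theory Submission
  imports Defs
begin

text \<open>By the cycle lemma the vertices of the two layers are, uniquely, the rotations of \<open>0w\<close> and of
  \<open>1w\<close> for Dyck words \<open>w\<close>. Alternately flipping the leading \<open>0\<close> and going from \<open>01u0v\<close> to \<open>01u1v\<close>,
  a rotation of \<open>1w'\<close> with \<open>w' = u1v0\<close>, gives a 2-factor. The map from \<open>1u0v\<close> to \<open>u1v0\<close> rotates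
  the plane tree encoded by the word; its period divides \<open>2n\<close>, which is coprime to \<open>2n + 1\<close>, so each
  cycle of the 2-factor consists of all rotations of all words of one plane tree.

  Pulling a leaf, \<open>x = 110u0v\<close> to \<open>y = 101u0v\<close>, yields a 6-cycle meeting the cycle of \<open>x\<close> in two edges
  and that of \<open>y\<close> in one; its symmetric difference with the 2-factor joins both cycles. Every plane tree
  other than the star has a representative \<open>x\<close> for which the pull decreases the minimal sum of
  depths over all roots. Using one pull per tree thus joins everything to a Hamilton cycle, and the
  6-cycles never interfere, since each cycle is entered only once through two edges. Each 6-cycle may
  moreover be replaced by any of its \<open>2n + 1\<close> rotations. Two choices per tree already give
  \<open>2^(T - 1)\<close> Hamilton cycles, where \<open>T \<ge> 2^(n - 1) / 2n\<close> is the number of plane trees with \<open>n\<close> edges.\<close>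

section \<open>Dyck words and plane trees\<close>

datatype dyck = Emp | Nd dyck dyck

fun word :: "dyck \<Rightarrow> bool list" where
  "word Emp = []"
| "word (Nd u v) = True # word u @ False # word v"

fun nodes :: "dyck \<Rightarrow> nat" where
  "nodes Emp = 0"
| "nodes (Nd u v) = Suc (nodes u + nodes v)"

fun app :: "dyck \<Rightarrow> dyck \<Rightarrow> dyck" where
  "app Emp b = b"
| "app (Nd u v) b = Nd u (app v b)"

fun turn :: "dyck \<Rightarrow> dyck" where
  "turn Emp = Emp"
| "turn (Nd u v) = app u (Nd v Emp)"

lemma app_Emp [simp]: "app a Emp = a"
  by (induction a) auto

lemma app_assoc: "app (app a b) c = app a (app b c)"
  by (induction a) auto

lemma word_app [simp]: "word (app a b) = word a @ word b"
  by (induction a) auto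

lemma nodes_app [simp]: "nodes (app a b) = nodes a + nodes b"
  by (induction a) auto

lemma length_word [simp]: "length (word t) = 2 * nodes t"
  by (induction t) auto

lemma count_word: "count_list (word t) c = nodes t"
  by (induction t) auto

lemma nodes_turn [simp]: "nodes (turn t) = nodes t"
  by (cases t) auto

lemma nodes_funpow_turn [simp]: "nodes ((turn ^^ k) t) = nodes t"
  by (induction k) auto

text \<open>A tree costs two turns for each of its nodes. On \<open>Nd u v\<close> followed by
  \<open>b\<close>, one turn exposes \<open>u\<close>, the hypothesis moves \<open>u\<close> behind
  the rest, one more turn exposes \<open>v\<close>, and the hypothesis moves \<open>v\<close> behind
  \<open>b\<close>.\<close>

lemma funpow_turn_app: "(turn ^^ (2 * nodes a)) (app a b) = app b a"
proof (induction a arbitrary: b)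
  case (Nd u v)
  have "2 * nodes (Nd u v) = 2 * nodes v + (1 + (2 * nodes u + 1))"
    by simp
  moreover have "(turn ^^ 1) (app (Nd u v) b) = app u (Nd (app v b) Emp)"
    by simp
  ultimately show ?case
    by (simp only: funpow_add comp_apply Nd.IH) (simp add: Nd.IH app_assoc)
qed simp

lemma funpow_turn_period [simp]: "(turn ^^ (2 * nodes t)) t = t"
  using funpow_turn_app[of t Emp] by simp

section \<open>Plane trees as classes of words under turning\<close>

definition cls :: "dyck \<Rightarrow> dyck set" where
  "cls t = range (\<lambda>k. (turn ^^ k) t)"

lemma self_in_cls [simp]: "t \<in> cls t"
  unfolding cls_def by (rule range_eqI[of _ _ 0]) simp

lemma funpow_turn_in_cls [simp]: "(turn ^^ k) t \<in> cls t"
  unfolding cls_def by simp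

lemma nodes_cls: "t' \<in> cls t \<Longrightarrow> nodes t' = nodes t"
  unfolding cls_def by auto

lemma funpow_turn_mult: "(turn ^^ (2 * nodes t * k)) t = t"
  by (induction k) (simp_all add: funpow_add)

lemma cls_sym:
  assumes "t' \<in> cls t" shows "t \<in> cls t'"
proof -
  obtain k where k: "t' = (turn ^^ k) t"
    using assms unfolding cls_def by auto
  show ?thesis
  proof (cases "nodes t = 0")
    case True
    then have "t = Emp" by (cases t) auto
    then show ?thesis using nodes_cls[OF assms] by (cases t') auto
  next
    case False
    \<comment> \<open>Since \<open>2 * nodes t * k\<close> is a multiple of the period and at least
      \<open>k\<close>, going on to it from \<open>t'\<close> leads back to
      \<open>t\<close>.\<close>
    then have "k \<le> 2 * nodes t * k" by simp
    then have "(turn ^^ (2 * nodes t * k - k)) t' = (turn ^^ (2 * nodes t * k)) t"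
      unfolding k by (metis comp_apply funpow_add le_add_diff_inverse2)
    then show ?thesis
      by (metis funpow_turn_mult funpow_turn_in_cls)
  qed
qed

lemma cls_trans: "\<lbrakk>a \<in> cls b; b \<in> cls c\<rbrakk> \<Longrightarrow> a \<in> cls c"
  unfolding cls_def by (auto simp flip: comp_apply[of "turn ^^ _"] funpow_add)

lemma cls_eqI: "t' \<in> cls t \<Longrightarrow> cls t' = cls t"
  by (blast intro: cls_trans cls_sym)

lemma cls_subset_bounded: "nodes t = n \<Longrightarrow> n \<ge> 1 \<Longrightarrow> cls t \<subseteq> (\<lambda>k. (turn ^^ k) t) ` {..<2 * n}"
proof
  fix t' assume n: "nodes t = n" "n \<ge> 1" and "t' \<in> cls t"
  then obtain k where k: "t' = (turn ^^ k) t" unfolding cls_def by auto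
  have "(turn ^^ k) t = (turn ^^ (k mod (2 * n) + 2 * n * (k div (2 * n)))) t"
    by simp
  also have "\<dots> = (turn ^^ (k mod (2 * n))) t"
    using funpow_turn_mult[of t] n(1) by (simp only: funpow_add comp_apply)
  finally show "t' \<in> (\<lambda>k. (turn ^^ k) t) ` {..<2 * n}"
    using k n(2) by auto
qed

section \<open>Depth sums, leaf pulls and the descent to the star\<close>

text \<open>Depths are counted in the ordered forest whose bracket word is \<^term>\<open>word t\<close>: in \<open>1u0v\<close> the
  word \<open>u\<close> encodes the children of the first root.\<close>

fun depth_sum :: "dyck \<Rightarrow> nat" where
  "depth_sum Emp = 0"
| "depth_sum (Nd u v) = depth_sum u + nodes u + depth_sum v"

text \<open>The minimal depth sum over all choices of the root of the plane tree.\<close>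

definition potential :: "dyck \<Rightarrow> nat" where
  "potential t = (LEAST d. d \<in> depth_sum ` cls t)"

fun pull :: "dyck \<Rightarrow> dyck" where
  "pull (Nd (Nd Emp u) v) = Nd Emp (Nd u v)"
| "pull t = t"

text \<open>A word of minimal depth sum may offer a pull only deep inside, whereas
  \<open>pull\<close> acts at the front. The relation allows a pull anywhere; turning brings it to
  the front afterwards.\<close>

inductive pulls :: "dyck \<Rightarrow> dyck \<Rightarrow> bool" where
  top: "pulls (Nd (Nd Emp u) v) (Nd Emp (Nd u v))"
| left: "pulls a a' \<Longrightarrow> pulls (Nd a b) (Nd a' b)"
| right: "pulls b b' \<Longrightarrow> pulls (Nd a b) (Nd a b')"

lemma nodes_pulls: "pulls t t' \<Longrightarrow> nodes t' = nodes t"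
  by (induction rule: pulls.induct) auto

lemma depth_sum_pulls: "pulls t t' \<Longrightarrow> depth_sum t' < depth_sum t"
  by (induction rule: pulls.induct) (auto simp: nodes_pulls)

text \<open>The same number of turns serves both words, because a pull leaves the node counts of all
  blocks that are moved unchanged. The trailing \<open>b\<close> makes the induction go through: it
  absorbs whatever is turned past the place of the pull.\<close>

lemma pulls_to_top:
  "pulls t t' \<Longrightarrow> \<exists>k u v. (turn ^^ k) (app t b) = Nd (Nd Emp u) v \<and>
                         (turn ^^ k) (app t' b) = Nd Emp (Nd u v)"
proof (induction arbitrary: b rule: pulls.induct)
  case (top u v)
  show ?case by (rule exI[of _ 0]) simp
next
  case (left a a' c)
  obtain k u v where "(turn ^^ k) (app a (Nd (app c b) Emp)) = Nd (Nd Emp u) v"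
    "(turn ^^ k) (app a' (Nd (app c b) Emp)) = Nd Emp (Nd u v)"
    using left.IH by blast
  then show ?case
    by (intro exI[of _ "Suc k"] exI) (simp add: funpow_Suc_right del: funpow.simps(2))
next
  case (right c c' a)
  obtain k u v where k: "(turn ^^ k) (app c (app b (Nd a Emp))) = Nd (Nd Emp u) v"
    "(turn ^^ k) (app c' (app b (Nd a Emp))) = Nd Emp (Nd u v)"
    using right.IH by blast
  have "(turn ^^ (2 * nodes (Nd a Emp))) (app (Nd a w) b) = app w (app b (Nd a Emp))" for w
    using funpow_turn_app[of "Nd a Emp" "app w b"] by (simp add: app_assoc del: funpow.simps(2))
  then show ?case using k
    by (intro exI[of _ "k + 2 * nodes (Nd a Emp)"] exI) (simp only: funpow_add comp_apply)
qed

fun star :: "nat \<Rightarrow> dyck" where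
  "star 0 = Emp"
| "star (Suc n) = Nd Emp (star n)"

lemma nodes_star [simp]: "nodes (star n) = n"
  by (induction n) auto

text \<open>If no pull is possible inside \<open>u\<close> or \<open>v\<close>, both are stars; then
  either \<open>u\<close> is empty and the whole is a star, or the first leaf of \<open>u\<close>
  can be pulled at the top.\<close>

lemma star_or_pulls: "t = star (nodes t) \<or> (\<exists>t'. pulls t t')"
proof (induction t)
  case (Nd u v)
  show ?case
  proof (cases "\<exists>t'. pulls u t' \<or> pulls v t'")
    case True
    then show ?thesis by (blast intro: pulls.left pulls.right)
  next
    case False
    then have "u = star (nodes u)" and v: "v = star (nodes v)"
      using Nd.IH by blast+
    then show ?thesis
      by (cases "nodes u") (auto intro: pulls.top)
  qed
qed simp

lemma potential_le: "t' \<in> cls t \<Longrightarrow> potential t \<le> depth_sum t'"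
  unfolding potential_def by (rule Least_le) auto

lemma potential_cls: "t' \<in> cls t \<Longrightarrow> potential t' = potential t"
  unfolding potential_def by (simp add: cls_eqI)

text \<open>Root the tree so that the depth sum attains the potential. A pull there lowers the depth
  sum, which bounds the potential of the new tree, and turning the pull to the front changes neither
  class.\<close>

lemma ex_descending_pull:
  assumes "cls t \<noteq> cls (star (nodes t))"
  shows "\<exists>u v. Nd (Nd Emp u) v \<in> cls t \<and> potential (Nd Emp (Nd u v)) < potential t"
proof -
  have "potential t \<in> depth_sum ` cls t"
    unfolding potential_def by (rule LeastI[of _ "depth_sum t"]) simp
  then obtain w where w: "w \<in> cls t" "depth_sum w = potential t" by auto
  have "w \<noteq> star (nodes w)"
    using assms w(1) cls_eqI nodes_cls by metis
  then obtain w' where w': "pulls w w'" using star_or_pulls by blast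
  obtain k u v where k: "(turn ^^ k) w = Nd (Nd Emp u) v" "(turn ^^ k) w' = Nd Emp (Nd u v)"
    using pulls_to_top[OF w', of Emp] by auto
  have "potential (Nd Emp (Nd u v)) = potential w'"
    using k(2) by (metis potential_cls funpow_turn_in_cls)
  also have "\<dots> \<le> depth_sum w'" by (simp add: potential_le)
  also have "\<dots> < potential t" using depth_sum_pulls[OF w'] w(2) by simp
  finally show ?thesis
    using k(1) w(1) by (metis cls_trans funpow_turn_in_cls)
qed

section \<open>The cycle lemma\<close>

text \<open>Unique parsing: if what follows is empty or starts with a closing bracket, neither word
  can extend beyond the other. In the induction the closing bracket after \<open>word u\<close>
  supplies this condition.\<close>

lemma word_cancel:
  assumes "word s @ a = word t @ b" "a = [] \<or> \<not> hd a" "b = [] \<or> \<not> hd b"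
  shows "s = t \<and> a = b"
  using assms
proof (induction s arbitrary: t a b)
  case Emp
  then show ?case by (cases t) auto
next
  case (Nd u v)
  show ?case
  proof (cases t)
    case Emp
    then show ?thesis using Nd.prems by auto
  next
    case [simp]: (Nd u' v')
    have "u = u' \<and> False # word v @ a = False # word v' @ b"
      using Nd.prems by (intro Nd.IH(1)) auto
    then show ?thesis using Nd.IH(2)[of a v' b] Nd.prems by auto
  qed
qed

lemma word_inj: "word s = word t \<Longrightarrow> s = t"
  using word_cancel[of s "[]" t "[]"] by simp

lemma word_Nd_split:
  assumes "word (Nd u v) = a @ b"
  obtains "a = []"
  | a' r where "a = True # a'" "word u = a' @ r" "b = r @ False # word v"
  | r where "a = True # word u @ False # r" "word v = r @ b"
proof (cases a)
  case (Cons c a')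
  then have "word u @ (False # word v) = a' @ b" "c = True" using assms by auto
  then show ?thesis
    using Cons that(2,3) by (auto simp: append_eq_append_conv2 append_eq_Cons_conv Cons_eq_append_conv)
qed (use that in blast)

lemma word_prefix:
  "word t = a @ b \<Longrightarrow> count_list a False \<le> count_list a True"
proof (induction t arbitrary: a b)
  case (Nd u v)
  from Nd.prems show ?case
  proof (cases rule: word_Nd_split)
    case (2 a' r)
    then show ?thesis using Nd.IH(1)[of a' r] by simp
  next
    case (3 r)
    then show ?thesis using Nd.IH(2)[of r b] by (simp add: count_word)
  qed simp
qed simp

lemma word_insert:
  "word t = a @ b \<Longrightarrow> \<exists>t'. word t' = a @ True # False # b"
proof (induction t arbitrary: a b)
  case Emp
  then show ?case by (intro exI[of _ "Nd Emp Emp"]) simp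
next
  case (Nd u v)
  from Nd.prems show ?case
  proof (cases rule: word_Nd_split)
    case 1
    then show ?thesis using Nd.prems by (intro exI[of _ "Nd Emp (Nd u v)"]) simp
  next
    case (2 a' r)
    then obtain u' where "word u' = a' @ True # False # r" using Nd.IH(1) by blast
    then show ?thesis using 2 by (intro exI[of _ "Nd u' v"]) simp
  next
    case (3 r)
    then obtain v' where "word v' = r @ True # False # b" using Nd.IH(2) by blast
    then show ?thesis using 3 by (intro exI[of _ "Nd u v'"]) simp
  qed
qed

lemma rotate_inj: "rotate k xs = rotate k ys \<Longrightarrow> xs = ys"
  by (metis bij_is_inj bij_rotate1 inj_fn injD rotate_def)

lemma count_rotate [simp]: "count_list (rotate k xs) d = count_list xs d"
proof (induction k)
  case (Suc k)
  have "count_list (rotate1 ys) d = count_list ys d" for ys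
    by (cases ys) auto
  then show ?case using Suc.IH by simp
qed simp

lemma count_True_False: "count_list xs True + count_list xs False = length xs"
  by (induction xs) auto

lemma ex_rotate_Cons: "x \<in> set xs \<Longrightarrow> \<exists>k ys. rotate k xs = x # ys"
  by (metis append_Cons in_set_conv_decomp rotate_append)

lemma ex_rotate_True_False:
  assumes "True \<in> set xs" "False \<in> set xs"
  shows "\<exists>k ys. rotate k xs = True # False # ys"
proof -
  obtain k ys where k: "rotate k xs = True # ys"
    using ex_rotate_Cons[OF assms(1)] by blast
  have "False \<in> set (rotate k xs)" using assms(2) by simp
  then have "False \<in> set ys" unfolding k by simp
  then obtain a b where ys: "ys = a @ False # b" "False \<notin> set a"
    by (metis split_list_first)
  \<comment> \<open>All bits before the first \<open>False\<close> are \<open>True\<close>, so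
    \<open>True # a\<close> is \<open>a @ [True]\<close> and rotating past \<open>a\<close> leaves a
    single \<open>True\<close> before that \<open>False\<close>.\<close>
  have "rotate (length a) (True # ys) = True # False # b @ replicate (length a) True"
  proof -
    have a: "a = replicate (length a) True"
      using ys(2) by (metis (full_types) replicate_length_same)
    have "True # ys = a @ (True # False # b)"
      using ys(1) a by (metis append_Cons replicate_Suc replicate_append_same append.assoc append_Nil)
    then show ?thesis using a rotate_append by (metis append_Cons)
  qed
  then have "rotate (length a + k) xs = True # False # b @ replicate (length a) True"
    using k by (metis rotate_rotate)
  then show ?thesis by blast
qed

text \<open>The existence part of the cycle lemma, by deleting and reinserting a cyclic factor \<open>10\<close>.\<close>

lemma ex_rotate_word:
  "count_list xs c = Suc (count_list xs (\<not> c)) \<Longrightarrow> \<exists>k t. rotate k xs = c # word t"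
proof (induction "length xs" arbitrary: xs rule: less_induct)
  case less
  show ?case
  proof (cases "(\<not> c) \<in> set xs")
    case False
    then have "x = c" if "x \<in> set xs" for x using that by (cases x; cases c) auto
    then have "set xs \<subseteq> {c}" by blast
    moreover from this have "length xs = 1"
      using less.prems False count_True_False[of xs] by (cases c) auto
    ultimately have "xs = [c]" by (cases xs) auto
    then show ?thesis by (intro exI[of _ 0] exI[of _ Emp]) simp
  next
    case True
    moreover have "c \<in> set xs" using less.prems by (metis count_notin nat.distinct(1))
    ultimately have "True \<in> set xs" "False \<in> set xs" by (cases c; auto)+
    then obtain k ys where k: "rotate k xs = True # False # ys"
      using ex_rotate_True_False by blast
    have cnt: "count_list (rotate k xs) d = count_list xs d" for d
      by simp
    have "length ys < length xs" using k by (metis length_rotate length_Cons lessI less_Suc_eq)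
    moreover have "count_list ys c = Suc (count_list ys (\<not> c))"
      using less.prems cnt[of c] cnt[of "\<not> c"] unfolding k by (cases c) auto
    ultimately obtain j t where "rotate j ys = c # word t" using less.hyps by blast
    then obtain p q where pq: "ys = p @ q" "q @ p = c # word t"
      by (metis append_take_drop_id rotate_drop_take)
    have "\<exists>j t. rotate j (True # False # ys) = c # word t"
    \<comment> \<open>If \<open>q\<close> is empty, \<open>c\<close> heads \<open>ys\<close> and the
      factor 10 goes behind the whole word. Otherwise \<open>c\<close> heads \<open>q\<close>, and
      the factor goes between the rest of \<open>q\<close> and \<open>p\<close>.\<close>
    proof (cases q)
      case Nil
      then have "rotate 2 (True # False # ys) = c # word (app t (Nd Emp Emp))"
        using pq rotate_append[of "[True, False]" ys] by (simp add: numeral_2_eq_2)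
      then show ?thesis by blast
    next
      case (Cons d q')
      then have "word t = q' @ p" using pq by simp
      then obtain t' where "word t' = q' @ True # False # p" using word_insert by blast
      then have "rotate (length (True # False # p)) ((True # False # p) @ q) = c # word t'"
        using pq Cons by (simp only: rotate_append) simp
      then show ?thesis using pq(1) by (metis append_Cons)
    qed
    then show ?thesis unfolding k[symmetric] rotate_rotate by blast
  qed
qed

text \<open>Uniqueness in the cycle lemma. A shift \<open>d > 0\<close> cuts \<open>word t\<close>
  into \<open>p @ q\<close>; the prefix inequality, applied to prefixes of both
  \<open>word t\<close> and \<open>word s\<close>, then contradicts the balance of
  \<open>p @ q\<close>.\<close>

lemma rotate_word_unique:
  assumes eq: "rotate d (c # word t) = c # word s" and d: "d < length (c # word t)"
  shows "d = 0"
proof (rule ccontr)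
  assume "d \<noteq> 0"
  define p q where "p = take d (word t)" and "q = drop d (word t)"
  have pq: "word t = p @ q" by (simp add: p_def q_def)
  have "length p = d" using d by (simp add: p_def)
  then have p: "length p = d" "p \<noteq> []" using \<open>d \<noteq> 0\<close> by auto
  have t: "count_list p e + count_list q e = nodes t" for e
    using count_word[of t e] unfolding pq by simp
  show False
  proof (cases c)
    case True
    obtain a p' where a: "True # p = p' @ [a]" "length p' = d"
      using p by (metis append_butlast_last_id length_append_singleton length_Cons list.distinct(1) nat.inject)
    have "(True # p) @ q = (p' @ [a]) @ q" using a(1) by (rule arg_cong)
    then have "c # word t = p' @ (a # q)" using True pq by simp
    then have "rotate (length p') (p' @ (a # q)) = c # word s" using eq a(2) by simp
    then have "True # word s = (a # q) @ p'" unfolding rotate_append using True by simp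
    then have "word s = q @ p'" "a" by auto
    then have "count_list q False \<le> count_list q True" using word_prefix by blast
    moreover obtain p'' where "p' = True # p''" using a p by (cases p') auto
    then have p'': "p = p'' @ [True]" using a \<open>a\<close> by simp
    then have "count_list p'' False \<le> count_list p'' True"
      using pq by (intro word_prefix[of t _ "True # q"]) simp
    ultimately show False using t[of True] t[of False] p'' by simp
  next
    case False
    \<comment> \<open>Moving the leading \<open>False\<close> to the end makes the cut fall exactly
      between \<open>p\<close> and \<open>q\<close>.\<close>
    have "rotate (length p) (p @ (q @ [False])) = (q @ [False]) @ p" by (rule rotate_append)
    moreover have "rotate d (word t @ [False]) = rotate1 (rotate d (False # word t))"
      by (metis rotate1.simps(2) rotate1_rotate_swap)
    ultimately have "q @ False # p = word s @ [False]"
      using eq False p pq by simp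
    then have "word s = q @ False # butlast p"
      using p by (metis butlast.simps(2) butlast_append butlast_snoc list.distinct(1))
    then have "count_list (q @ [False]) False \<le> count_list (q @ [False]) True"
      by (intro word_prefix[of s _ "butlast p"]) simp
    moreover have "count_list p False \<le> count_list p True"
      using word_prefix pq by blast
    ultimately show False using t[of True] t[of False] by simp
  qed
qed

section \<open>Coordinates on the two layers: a Dyck word and a shift\<close>

definition vert :: "bool \<Rightarrow> dyck \<times> nat \<Rightarrow> bool list" where
  "vert c s = rotate (snd s) (c # word (fst s))"

text \<open>One index set serves both layers: by the cycle lemma \<open>vert True\<close> enumerates
  the upper and \<open>vert False\<close> the lower layer over it without repetition. Vertices with
  equal index differ only in the bit \<open>c\<close> and are adjacent.\<close>

definition index :: "nat \<Rightarrow> (dyck \<times> nat) set" where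
  "index n = {t. nodes t = n} \<times> {..<2 * n + 1}"

text \<open>Adding \<open>2n\<close> to the second component rotates by one position to the right.\<close>

definition step :: "nat \<Rightarrow> dyck \<times> nat \<Rightarrow> dyck \<times> nat" where
  "step n s = (turn (fst s), (snd s + 2 * n) mod (2 * n + 1))"

lemma vert_inj: "inj_on (vert c) (index n)"
proof -
  have *: "a = b" if "vert c a = vert c b" "snd a \<le> snd b" "a \<in> index n" "b \<in> index n" for a b
  proof -
    obtain s i t j where ab: "a = (s, i)" "b = (t, j)" by (metis surj_pair)
    have "rotate i (c # word s) = rotate i (rotate (j - i) (c # word t))"
      using that(1,2) unfolding ab by (simp add: vert_def rotate_rotate)
    then have eq: "rotate (j - i) (c # word t) = c # word s" by (metis rotate_inj)
    then have "j - i = 0"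
      by (rule rotate_word_unique) (use that ab in \<open>auto simp: index_def\<close>)
    then show ?thesis using that(2) eq ab word_inj by auto
  qed
  show ?thesis
    by (rule inj_onI) (metis * nle_le)
qed

lemma vert_mod: "nodes t = n \<Longrightarrow> vert c (t, i mod (2 * n + 1)) = rotate i (c # word t)"
  unfolding vert_def by (metis fst_conv snd_conv rotate_conv_mod length_Cons length_word Suc_eq_plus1)

lemma vert_image: "vert c ` index n = bitstrings (2 * n + 1) (if c then n + 1 else n)"
proof (intro set_eqI iffI)
  fix x assume "x \<in> vert c ` index n"
  then show "x \<in> bitstrings (2 * n + 1) (if c then n + 1 else n)"
    by (auto simp: vert_def index_def bitstrings_def count_word)
next
  fix x assume x: "x \<in> bitstrings (2 * n + 1) (if c then n + 1 else n)"
  with count_True_False[of x] have "count_list x c = Suc (count_list x (\<not> c))"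
    by (auto simp: bitstrings_def split: if_splits)
  then obtain k t where k: "rotate k x = c # word t" using ex_rotate_word by blast
  have len: "length x = 2 * n + 1" using x by (simp add: bitstrings_def)
  then have t: "nodes t = n" using arg_cong[OF k, of length] by simp
  \<comment> \<open>Rotating by a multiple of the length is the identity, so
    \<open>2 * n * k\<close> further positions undo the rotation by \<open>k\<close>.\<close>
  have "x = rotate (length x * k) x" by (metis mod_mult_self1_is_0 rotate0 rotate_conv_mod id_apply)
  also have "length x * k = 2 * n * k + k" using len by simp
  also have "rotate (2 * n * k + k) x = rotate (2 * n * k) (c # word t)"
    using k by (metis rotate_rotate)
  also have "\<dots> = vert c (t, (2 * n * k) mod (2 * n + 1))" by (simp only: vert_mod[OF t])
  finally show "x \<in> vert c ` index n" using t by (auto simp: index_def)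
qed

lemma vert_disjoint: "vert c ` index n \<inter> vert (\<not> c) ` index n = {}"
  unfolding vert_image by (auto simp: bitstrings_def split: if_splits)

lemma vert_neq: "a \<in> index n \<Longrightarrow> b \<in> index n \<Longrightarrow> vert True a \<noteq> vert False b"
  using vert_disjoint[of True n] by auto

lemma middle_layer_verts_eq: "middle_layer_verts n = vert False ` index n \<union> vert True ` index n"
  by (simp add: middle_layer_verts_def vert_image)

lemma differ_in_one_bit_append:
  assumes "a \<noteq> b" shows "differ_in_one_bit (p @ a # s) (p @ b # s)"
proof -
  have "{i. i < length (p @ a # s) \<and> (p @ a # s) ! i \<noteq> (p @ b # s) ! i} = {length p}"
    using assms by (auto simp: nth_append nth_Cons' split: if_splits)
  then show ?thesis by (simp add: differ_in_one_bit_def)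
qed

lemma differ_in_one_bit_rotate:
  assumes "a \<noteq> b" shows "differ_in_one_bit (rotate k (p @ a # s)) (rotate k (p @ b # s))"
proof -
  have "\<exists>p' s'. rotate k (p @ a # s) = p' @ a # s' \<and> rotate k (p @ b # s) = p' @ b # s'"
  proof (induction k)
    case (Suc k)
    then obtain p' s' where "rotate k (p @ a # s) = p' @ a # s'" "rotate k (p @ b # s) = p' @ b # s'"
      by blast
    then show ?case
      by (cases p'; simp) (metis append_Cons append_assoc, metis append_Nil)
  qed auto
  then show ?thesis using differ_in_one_bit_append[OF assms] by metis
qed

lemma middle_layer_edgeI:
  assumes "r \<in> index n" "s \<in> index n"
    "vert c r = rotate k (p @ a # q)" "vert d s = rotate k (p @ (\<not> a) # q)"
  shows "{vert c r, vert d s} \<in> middle_layer_edges n"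
proof -
  have "vert c r \<in> middle_layer_verts n" "vert d s \<in> middle_layer_verts n"
    using assms(1,2) unfolding middle_layer_verts_eq by (cases c; cases d; auto)+
  moreover have "differ_in_one_bit (vert c r) (vert d s)"
    unfolding assms(3,4) by (rule differ_in_one_bit_rotate) simp
  ultimately show ?thesis unfolding middle_layer_edges_def by blast
qed

section \<open>The 2-factor\<close>

lemma step_in_index [intro]: "s \<in> index n \<Longrightarrow> step n s \<in> index n"
  by (auto simp: index_def step_def)

lemma funpow_step_in_index [intro]: "s \<in> index n \<Longrightarrow> (step n ^^ k) s \<in> index n"
  by (induction k) auto

lemma funpow_step:
  assumes "i < 2 * n + 1"
  shows "(step n ^^ k) (t, i) = ((turn ^^ k) t, (i + 2 * n * k) mod (2 * n + 1))"
proof (induction k)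
  case (Suc k)
  then show ?case by (simp add: step_def mod_simps algebra_simps del: mod_Suc_eq)
qed (use assms in simp)

lemma funpow_step_period:
  assumes "s \<in> index n"
  shows "(step n ^^ (2 * n * (2 * n + 1))) s = s"
proof -
  obtain t i where s: "s = (t, i)" by fastforce
  have "(i + 2 * n * (2 * n * (2 * n + 1))) mod (2 * n + 1) = i"
    using assms unfolding s index_def
    by (metis mem_Sigma_iff lessThan_iff mod_less mod_mult_self1 mult.assoc mult.commute)
  moreover have "(turn ^^ (2 * n * (2 * n + 1))) t = t"
    using assms funpow_turn_mult[of t "2 * n + 1"] by (auto simp: s index_def)
  ultimately show ?thesis
    using assms unfolding s by (subst funpow_step) (auto simp: index_def)
qed

text \<open>Taking \<open>k + 2 * n * m\<close> steps always gives the \<open>k\<close>-th turn of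
  the word, while each increase of \<open>m\<close> by one raises the shift by one modulo
  \<open>2 * n + 1\<close>. Hence word and shift can be prescribed independently.\<close>

lemma orbit_step:
  assumes "(t, i) \<in> index n"
  shows "range (\<lambda>k. (step n ^^ k) (t, i)) = cls t \<times> {..<2 * n + 1}"
proof (intro equalityI subsetI)
  fix s assume "s \<in> range (\<lambda>k. (step n ^^ k) (t, i))"
  then show "s \<in> cls t \<times> {..<2 * n + 1}"
    using assms by (auto simp: index_def funpow_step)
next
  fix s assume "s \<in> cls t \<times> {..<2 * n + 1}"
  then obtain k j where s: "s = ((turn ^^ k) t, j)" "j < 2 * n + 1"
    unfolding cls_def by auto
  \<comment> \<open>\<open>2n\<close> is \<open>-1\<close> modulo \<open>2n + 1\<close>.\<close>
  define m where "m = j + 2 * n * i + k"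
  have "(turn ^^ (k + 2 * n * m)) t = (turn ^^ k) t"
    using assms funpow_turn_mult[of t m] by (auto simp: index_def funpow_add)
  moreover have "(i + 2 * n * (k + 2 * n * m)) mod (2 * n + 1) = j"
  proof (cases "n = 0")
    case False
    then obtain q where q: "2 * n = Suc q" by (metis mult_is_0 not0_implies_Suc numeral_2_eq_2 nat.distinct(1))
    have "i + 2 * n * (k + 2 * n * m) = j + (2 * n + 1) * (i * (1 + q * Suc q) + k * Suc q + q * j)"
      unfolding m_def q by (simp add: algebra_simps)
    then show ?thesis using s(2) by (simp del: mult_Suc)
  qed (use assms s(2) in \<open>auto simp: index_def\<close>)
  ultimately have "s = (step n ^^ (k + 2 * n * m)) (t, i)"
    using assms s by (subst funpow_step) (auto simp: index_def)
  then show "s \<in> range (\<lambda>k. (step n ^^ k) (t, i))" by blast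
qed

lemma rotate_append_mod: "k mod length (p @ q) = length p \<Longrightarrow> rotate k (p @ q) = q @ p"
  by (metis rotate_append rotate_conv_mod)

lemma vert_shift:
  assumes "nodes t = n" "c # word t = p @ q" "k mod (2 * n + 1) = length p"
  shows "vert c (t, (i + k) mod (2 * n + 1)) = rotate i (q @ p)"
proof -
  have "length (p @ q) = 2 * n + 1" using assms(1) arg_cong[OF assms(2), of length] by simp
  then have "rotate k (p @ q) = q @ p" using assms(3) by (intro rotate_append_mod) simp
  then show ?thesis using vert_mod[OF assms(1)] assms(2) by (metis rotate_rotate)
qed

text \<open>Written with the shift \<open>i\<close> from before the step, so that it can be compared
  with \<open>vert False (Nd u v, i)\<close>: only the closing bracket of the first tree has been
  flipped.\<close>

lemma vert_step:
  assumes "nodes (Nd u v) = n"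
  shows "vert True (step n (Nd u v, i)) = rotate i (False # True # word u @ True # word v)"
proof -
  have "vert True (turn (Nd u v), (i + 2 * n) mod (2 * n + 1))
    = rotate i ([False] @ (True # word u @ True # word v))"
    by (rule vert_shift) (use assms in auto)
  then show ?thesis by (simp add: step_def)
qed

lemma vert_step3:
  assumes "nodes (Nd (Nd Emp u) v) = n" "i < 2 * n + 1"
  shows "vert c ((step n ^^ 3) (Nd (Nd Emp u) v, i))
    = rotate i (False # True # False # c # word u @ True # word v)"
proof -
  \<comment> \<open>Three steps shift by -3, that is by \<open>2 * n - 2\<close>, which moves the
    last three bits to the front.\<close>
  have "2 * n * 3 = (2 * n - 2) + 2 * (2 * n + 1)" using assms(1) by auto
  then have m: "2 * n * 3 mod (2 * n + 1) = 2 * n - 2" by (simp del: mult_Suc_right)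
  have "vert c (app u (Nd v (Nd Emp Emp)), (i + 2 * n * 3) mod (2 * n + 1))
    = rotate i ([False, True, False] @ (c # word u @ True # word v))"
    by (rule vert_shift) (use assms(1) m in auto)
  moreover have "(turn ^^ 3) (Nd (Nd Emp u) v) = app u (Nd v (Nd Emp Emp))"
    by (simp add: numeral_3_eq_3 app_assoc)
  ultimately show ?thesis using funpow_step[OF assms(2)] by simp
qed

lemma spoke_edge: "s \<in> index n \<Longrightarrow> {vert False s, vert True s} \<in> middle_layer_edges n"
  by (rule middle_layer_edgeI[of _ _ _ _ "snd s" "[]" False "word (fst s)"]) (auto simp: vert_def)

lemma step_edge:
  assumes "s \<in> index n" "n \<ge> 1"
  shows "{vert False s, vert True (step n s)} \<in> middle_layer_edges n"
proof -
  obtain u v i where s: "s = (Nd u v, i)" "nodes (Nd u v) = n"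
    using assms by (cases s; cases "fst s") (auto simp: index_def)
  show ?thesis
    by (rule middle_layer_edgeI[of _ _ _ _ i "False # True # word u" False "word v"])
      (use assms(1) s in \<open>auto simp: vert_step vert_def[of False]\<close>)
qed

text \<open>With \<open>x = 110u0v\<close>, \<open>y = 101u0v\<close> and \<open>z\<close> the third turn of \<open>x\<close>, the strings \<open>01abucv\<close> with
  \<open>0 < a + b + c < 3\<close>, rotated by \<open>i\<close>, form a 6-cycle which alternates between edges of the
  2-factor and the following three edges.\<close>

lemma hexagon_edges:
  assumes "x = Nd (Nd Emp u) v" "nodes x = n" "i < 2 * n + 1"
  shows "{vert True (step n (x, i)), vert False ((step n ^^ 3) (x, i))} \<in> middle_layer_edges n"
    "{vert True ((step n ^^ 3) (x, i)), vert False (pull x, i)} \<in> middle_layer_edges n"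
    "{vert True (step n (pull x, i)), vert False (x, i)} \<in> middle_layer_edges n"
proof -
  have x: "(x, i) \<in> index n" and y: "(pull x, i) \<in> index n"
    using assms by (auto simp: index_def)
  show "{vert True (step n (x, i)), vert False ((step n ^^ 3) (x, i))} \<in> middle_layer_edges n"
  proof (rule middle_layer_edgeI[OF step_in_index[OF x] funpow_step_in_index[OF x]])
    show "vert True (step n (x, i)) = rotate i ([False, True] @ True # False # word u @ True # word v)"
      using assms vert_step[of "Nd Emp u" v n i] by simp
  qed (use assms vert_step3[of u v n i False] in simp)
  show "{vert True ((step n ^^ 3) (x, i)), vert False (pull x, i)} \<in> middle_layer_edges n"
  proof (rule middle_layer_edgeI[OF funpow_step_in_index[OF x] y])
    show "vert True ((step n ^^ 3) (x, i)) = rotate i (([False, True, False, True] @ word u) @ True # word v)"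
      using assms vert_step3[of u v n i True] by simp
  qed (use assms in \<open>simp add: vert_def\<close>)
  show "{vert True (step n (pull x, i)), vert False (x, i)} \<in> middle_layer_edges n"
  proof (rule middle_layer_edgeI[OF step_in_index[OF y] x])
    show "vert True (step n (pull x, i)) = rotate i ([False, True, True] @ True # word u @ False # word v)"
      using assms vert_step[of Emp "Nd u v" n i] by simp
  qed (use assms in \<open>simp add: vert_def\<close>)
qed

section \<open>Cutting and joining cycles\<close>

fun path_edges :: "'a list \<Rightarrow> 'a set set" where
  "path_edges (x # y # zs) = insert {x, y} (path_edges (y # zs))"
| "path_edges _ = {}"

lemma path_edges_append:
  "\<lbrakk>xs \<noteq> []; ys \<noteq> []\<rbrakk> \<Longrightarrow> path_edges (xs @ ys) = insert {last xs, hd ys} (path_edges xs \<union> path_edges ys)"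
proof (induction xs rule: path_edges.induct)
  case ("2_2" x)
  then show ?case by (cases ys) auto
qed auto

lemma path_edges_rev [simp]: "path_edges (rev xs) = path_edges xs"
proof (induction xs rule: path_edges.induct)
  case (1 x y zs)
  then show ?case
    using path_edges_append[of "rev (y # zs)" "[x]"] by (auto simp: insert_commute)
qed auto

lemma path_edges_subset: "e \<in> path_edges xs \<Longrightarrow> e \<subseteq> set xs"
  by (induction xs rule: path_edges.induct) auto

lemma path_edges_conv_nth: "path_edges xs = {{xs ! i, xs ! Suc i} | i. Suc i < length xs}"
proof (induction xs rule: path_edges.induct)
  case (1 x y zs)
  have "{{(x # y # zs) ! i, (x # y # zs) ! Suc i} | i. Suc i < length (x # y # zs)}
    = insert {x, y} {{(y # zs) ! i, (y # zs) ! Suc i} | i. Suc i < length (y # zs)}"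
    (is "?l = ?r")
  proof (intro equalityI subsetI)
    fix e assume "e \<in> ?l"
    then obtain i where "e = {(x # y # zs) ! i, (x # y # zs) ! Suc i}" "Suc i < length (x # y # zs)" by blast
    then show "e \<in> ?r" by (cases i) auto
  next
    fix e assume "e \<in> ?r"
    then consider "e = {x, y}" | i where "e = {(y # zs) ! i, (y # zs) ! Suc i}" "Suc i < length (y # zs)"
      by blast
    then show "e \<in> ?l"
    proof cases
      case 1
      then show ?thesis by (intro CollectI exI[of _ 0]) simp
    next
      case (2 i)
      then show ?thesis by (intro CollectI exI[of _ "Suc i"]) simp
    qed
  qed
  then show ?case using 1 by simp
qed auto

lemma closed_walk_edges_conv_path:
  assumes "xs \<noteq> []"
  shows "closed_walk_edges xs = insert {last xs, hd xs} (path_edges xs)"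
proof (intro equalityI subsetI)
  fix e assume "e \<in> closed_walk_edges xs"
  then obtain i where i: "i < length xs" "e = {xs ! i, xs ! ((i + 1) mod length xs)}"
    unfolding closed_walk_edges_def by blast
  show "e \<in> insert {last xs, hd xs} (path_edges xs)"
  proof (cases "Suc i < length xs")
    case True
    then show ?thesis using i by (auto simp: path_edges_conv_nth)
  next
    case False
    then have "i + 1 = length xs" using i by simp
    then have "xs ! i = last xs" "(i + 1) mod length xs = 0"
      using assms by (auto simp: last_conv_nth simp flip: \<open>i + 1 = _\<close>)
    then show ?thesis using i assms by (simp add: hd_conv_nth)
  qed
next
  fix e assume "e \<in> insert {last xs, hd xs} (path_edges xs)"
  then consider "e = {last xs, hd xs}" | i where "e = {xs ! i, xs ! Suc i}" "Suc i < length xs"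
    unfolding path_edges_conv_nth by blast
  then show "e \<in> closed_walk_edges xs"
  proof cases
    case 1
    then show ?thesis using assms unfolding closed_walk_edges_def
      by (intro CollectI exI[of _ "length xs - 1"]) (simp add: last_conv_nth hd_conv_nth)
  next
    case (2 i)
    then show ?thesis unfolding closed_walk_edges_def by (intro CollectI exI[of _ i]) simp
  qed
qed

lemma closed_walk_edges_rotate [simp]: "closed_walk_edges (rotate k xs) = closed_walk_edges xs"
proof (induction k)
  case (Suc k)
  have "closed_walk_edges (rotate1 ys) = closed_walk_edges ys" for ys :: "'a list"
  proof (cases ys)
    case (Cons y zs)
    then show ?thesis
      using path_edges_append[of zs "[y]"] path_edges_append[of "[y]" zs]
      by (cases "zs = []") (auto simp: closed_walk_edges_conv_path insert_commute)
  qed simp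
  then show ?case using Suc by simp
qed simp

text \<open>Rotate so that the given edge becomes the closing edge, and reverse if it is traversed
  in the other direction.\<close>

lemma closed_walk_cut:
  assumes "distinct xs" "3 \<le> length xs" "{a, b} \<in> closed_walk_edges xs"
  obtains ys where "distinct ys" "set ys = set xs" "ys \<noteq> []" "hd ys = a" "last ys = b"
    "path_edges ys = closed_walk_edges xs - {{a, b}}"
proof -
  obtain i where i: "i < length xs" "{a, b} = {xs ! i, xs ! ((i + 1) mod length xs)}"
    using assms(3) unfolding closed_walk_edges_def by blast
  define zs where "zs = rotate (i + 1) xs"
  have zs: "distinct zs" "set zs = set xs" "3 \<le> length zs" "closed_walk_edges zs = closed_walk_edges xs"
    using assms(1,2) by (simp_all add: zs_def del: rotate_Suc)
  then have "zs \<noteq> []" by auto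
  have "hd zs = xs ! ((i + 1) mod length xs)"
    unfolding zs_def using i(1) by (intro hd_rotate_conv_nth) auto
  moreover have "last zs = xs ! i"
  proof -
    have "last zs = zs ! (length xs - 1)"
      using \<open>zs \<noteq> []\<close> by (simp add: last_conv_nth zs_def del: rotate_Suc)
    also have "\<dots> = xs ! ((i + 1 + (length xs - 1)) mod length xs)"
      unfolding zs_def using i(1) by (intro nth_rotate) auto
    also have "i + 1 + (length xs - 1) = i + length xs" using i(1) by linarith
    also have "(i + length xs) mod length xs = i" using i(1) by simp
    finally show ?thesis .
  qed
  ultimately have ends: "{a, b} = {last zs, hd zs}" using i(2) by simp
  \<comment> \<open>With at least three distinct vertices the closing edge does not occur a second
    time along the path.\<close>
  have "{last zs, hd zs} \<notin> path_edges zs"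
  proof -
    obtain x y ws where xy: "zs = x # y # ws" "ws \<noteq> []"
      using zs(3) by (cases zs; cases "tl zs"; cases "tl (tl zs)") auto
    have "last ws \<in> set ws" using xy(2) by simp
    then show ?thesis
      using zs(1) xy(2) path_edges_subset[of "{last ws, x}" "y # ws"] unfolding xy(1)
      by (auto simp: doubleton_eq_iff)
  qed
  then have cut: "path_edges zs = closed_walk_edges xs - {{a, b}}"
    using closed_walk_edges_conv_path[OF \<open>zs \<noteq> []\<close>] ends zs(4) by auto
  show ?thesis
  proof (cases "hd zs = a \<and> last zs = b")
    case True
    then show ?thesis using that[of zs] zs cut \<open>zs \<noteq> []\<close> by blast
  next
    case False
    then have "hd (rev zs) = a" "last (rev zs) = b"
      using ends by (auto simp: doubleton_eq_iff hd_rev last_rev)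
    then show ?thesis using that[of "rev zs"] zs cut \<open>zs \<noteq> []\<close> by simp
  qed
qed

text \<open>The surgery with a 6-cycle: \<open>xs\<close> loses one edge of it, \<open>p\<close> and
  \<open>q\<close> are what remains of another cycle after losing two, and the three connecting
  edges are the other edges of the 6-cycle.\<close>

lemma closed_walk_glue:
  assumes "distinct xs" "3 \<le> length xs" "{a, b} \<in> closed_walk_edges xs"
    and "p \<noteq> []" "q \<noteq> []" "distinct (p @ q)" "set xs \<inter> set (p @ q) = {}"
  obtains ys where "distinct ys" "3 \<le> length ys" "set ys = set xs \<union> set (p @ q)"
    "closed_walk_edges ys = (closed_walk_edges xs - {{a, b}}) \<union> path_edges p \<union> path_edges q \<union>
      {{last p, a}, {b, last q}, {hd q, hd p}}"
proof -
  obtain zs where zs: "distinct zs" "set zs = set xs" "zs \<noteq> []" "hd zs = a" "last zs = b"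
    "path_edges zs = closed_walk_edges xs - {{a, b}}"
    using closed_walk_cut[OF assms(1-3)] by metis
  let ?ys = "p @ zs @ rev q"
  show ?thesis
  proof (rule that[of ?ys])
    show "distinct ?ys" "set ?ys = set xs \<union> set (p @ q)" using assms zs by auto
    have "length zs = length xs" using zs(1,2) assms(1) by (metis distinct_card)
    then show "3 \<le> length ?ys" using assms(2) by simp
    show "closed_walk_edges ?ys = (closed_walk_edges xs - {{a, b}}) \<union> path_edges p \<union> path_edges q \<union>
      {{last p, a}, {b, last q}, {hd q, hd p}}"
    proof -
      have "closed_walk_edges ?ys = insert {hd q, hd p}
        (insert {last p, a} (path_edges p \<union> insert {b, last q} (path_edges zs \<union> path_edges q)))"
        using zs(3-5) assms(4,5)
        by (simp add: closed_walk_edges_conv_path path_edges_append last_rev hd_rev)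
      then show ?thesis unfolding zs(6)[symmetric] by blast
    qed
  qed
qed

section \<open>Joining the cycles of the 2-factor\<close>

text \<open>For a list of successive steps this follows a cycle of the 2-factor, alternating between
  spokes and step edges.\<close>

fun ladder :: "(dyck \<times> nat) list \<Rightarrow> bool list list" where
  "ladder [] = []"
| "ladder (s # ss) = vert True s # vert False s # ladder ss"

lemma ladder_append [simp]: "ladder (ss @ ss') = ladder ss @ ladder ss'"
  by (induction ss) auto

lemma ladder_eq_Nil [simp]: "ladder ss = [] \<longleftrightarrow> ss = []"
  by (cases ss) auto

lemma hd_ladder: "ss \<noteq> [] \<Longrightarrow> hd (ladder ss) = vert True (hd ss)"
  by (cases ss) auto

lemma last_ladder: "ss \<noteq> [] \<Longrightarrow> last (ladder ss) = vert False (last ss)"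
  by (induction ss) auto

lemma set_ladder: "set (ladder ss) = vert False ` set ss \<union> vert True ` set ss"
  by (induction ss) auto

lemma distinct_ladder:
  assumes "distinct ss" "set ss \<subseteq> index n"
  shows "distinct (ladder ss)"
  using assms
proof (induction ss)
  case (Cons s ss)
  have "vert c s \<notin> vert c ` set ss" for c
    using Cons.prems vert_inj[of c n] by (auto simp: inj_on_def)
  moreover have "vert True s \<noteq> vert False r" "vert False s \<noteq> vert True r" if "r \<in> index n" for r
    using Cons.prems vert_neq[of s n r] vert_neq[of r n s] that by auto
  ultimately show ?case
    using Cons by (auto simp: set_ladder) blast+
qed simp

text \<open>These are the edges of the 2-factor other than the spokes, labelled by their lower
  vertex. They alone are tracked later, since they suffice to recover the shifts that were
  chosen.\<close>

definition step_pair :: "nat \<Rightarrow> dyck \<times> nat \<Rightarrow> bool list set" where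
  "step_pair n s = {vert False s, vert True (step n s)}"

lemma path_edges_ladder:
  "successively (\<lambda>r s. s = step n r) ss \<Longrightarrow>
   path_edges (ladder ss) = (\<lambda>s. {vert True s, vert False s}) ` set ss \<union> step_pair n ` set (butlast ss)"
proof (induction ss rule: induct_list012)
  case (3 r s ss)
  let ?spoke = "\<lambda>s. {vert True s, vert False s}"
  have s: "s = step n r" and ss: "successively (\<lambda>r s. s = step n r) (s # ss)"
    using 3(3) unfolding successively.simps by blast+
  have "path_edges (ladder (r # s # ss))
    = insert (?spoke r) (insert {vert False r, vert True s} (path_edges (ladder (s # ss))))"
    by simp
  also have "path_edges (ladder (s # ss)) = ?spoke ` set (s # ss) \<union> step_pair n ` set (butlast (s # ss))"
    using 3(2) ss by blast
  also have "{vert False r, vert True s} = step_pair n r" unfolding s step_pair_def ..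
  finally have "path_edges (ladder (r # s # ss)) = insert (?spoke r) (insert (step_pair n r)
    (?spoke ` set (s # ss) \<union> step_pair n ` set (butlast (s # ss))))" .
  moreover have "butlast (r # s # ss) = r # butlast (s # ss)" by simp
  ultimately show ?case by (simp only: list.set image_insert) blast
qed simp_all

lemma eq_step_pair:
  assumes "r \<in> index n" "s \<in> index n" "w \<in> index n"
  shows "{vert False r, vert True s} = step_pair n w \<longleftrightarrow> w = r \<and> s = step n w"
proof -
  have "vert c r = vert c s \<longleftrightarrow> r = s" if "r \<in> index n" "s \<in> index n" for c r s
    using that inj_on_eq_iff[OF vert_inj] by blast
  moreover have "vert False r \<noteq> vert True (step n w)" using assms vert_neq by (metis step_in_index)
  ultimately show ?thesis
    using assms step_in_index[OF assms(3)] by (auto simp: step_pair_def doubleton_eq_iff)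
qed

definition region :: "nat \<Rightarrow> dyck \<Rightarrow> (dyck \<times> nat) set" where
  "region n t = cls t \<times> {..<2 * n + 1}"

lemma region_subset_index: "nodes t = n \<Longrightarrow> region n t \<subseteq> index n"
  by (auto simp: region_def index_def dest: nodes_cls)

lemma ex_orbit_list:
  assumes "(t, i) \<in> index n"
  obtains ss where "distinct ss" "ss \<noteq> []" "set ss = region n t" "hd ss = step n (t, i)" "last ss = (t, i)"
    "successively (\<lambda>r s. s = step n r) ss"
proof -
  define f s where "f = step n" and "s = (t, i)"
  define p where "p = (LEAST p. 0 < p \<and> (f ^^ p) s = s)"
  have "\<exists>p. 0 < p \<and> (f ^^ p) s = s"
  proof (cases "n = 0")
    case True
    then have "t = Emp" "i = 0" using assms by (cases t; auto simp: index_def)+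
    then show ?thesis using True by (intro exI[of _ 1]) (simp add: f_def s_def step_def)
  next
    case False
    then show ?thesis using funpow_step_period[OF assms] unfolding f_def s_def
      by (intro exI[of _ "2 * n * (2 * n + 1)"]) simp
  qed
  then have p: "0 < p" "(f ^^ p) s = s" unfolding p_def by (metis (mono_tags, lifting) LeastI)+
  \<comment> \<open>Iterates 1 to \<open>p\<close> rather than 0 to \<open>p - 1\<close>: the list
    then ends with \<open>s\<close>, and the step edge at \<open>s\<close> closes the cycle.\<close>
  define ss where "ss = map (\<lambda>k. (f ^^ k) s) [1..<Suc p]"
  have "(f ^^ j) s \<noteq> (f ^^ k) s" if "0 < j" "j < k" "k \<le> p" for j k
  proof
    assume "(f ^^ j) s = (f ^^ k) s"
    then have "(f ^^ (p - j + j)) s = (f ^^ (p - j + k)) s" by (simp add: funpow_add)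
    also have "p - j + k = (k - j) + p" using that by simp
    finally have "(f ^^ (k - j + p)) s = s" using p that by simp
    then have "(f ^^ (k - j)) s = s" by (metis p(2) funpow_add comp_apply)
    then have "p \<le> k - j" unfolding p_def using that by (intro Least_le) auto
    then show False using that by simp
  qed
  then have "inj_on (\<lambda>k. (f ^^ k) s) {1..<Suc p}"
    by (intro linorder_inj_onI') (auto simp: less_Suc_eq_le)
  then have "distinct ss" by (simp add: ss_def distinct_map del: upt_Suc)
  moreover have "set ss = region n t"
  proof -
    have "(f ^^ k) s \<in> (\<lambda>k. (f ^^ k) s) ` {1..<Suc p}" for k
    proof (cases "k mod p = 0")
      case True
      then have "(f ^^ k) s = (f ^^ p) s" using p funpow_mod_eq[OF p(2), of k] by simp
      then show ?thesis using p(1) by auto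
    next
      case False
      then show ?thesis using p funpow_mod_eq[OF p(2), of k]
        by (intro image_eqI[of _ _ "k mod p"]) (auto simp: less_Suc_eq_le less_imp_le)
    qed
    then have "set ss = range (\<lambda>k. (f ^^ k) s)" by (auto simp: ss_def simp del: upt_Suc)
    then show ?thesis using orbit_step[OF assms] by (simp add: f_def s_def region_def)
  qed
  moreover have "successively (\<lambda>r s. s = step n r) ss"
    unfolding successively_conv_nth by (auto simp: ss_def f_def simp del: upt_Suc)
  moreover have "hd ss = step n (t, i)" "last ss = (t, i)" "ss \<noteq> []"
    using p by (auto simp: ss_def hd_map last_map f_def s_def simp del: upt_Suc) 
  ultimately show ?thesis using that by blast
qed

lemma turn_inj: "turn a = turn b \<Longrightarrow> a = b"
proof -
  assume eq: "turn a = turn b"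
  then have "nodes a = nodes b" by (metis nodes_turn)
  have *: "(turn ^^ (2 * nodes t - 1)) (turn t) = t" if "nodes t \<noteq> 0" for t
  proof -
    have "(turn ^^ Suc (2 * nodes t - 1)) t = t"
      using that funpow_turn_period[of t] by (simp del: funpow.simps(2) funpow_turn_period)
    then show ?thesis by (simp only: funpow_Suc_right comp_apply)
  qed
  show ?thesis
  proof (cases "nodes a = 0")
    case True
    then show ?thesis using \<open>nodes a = nodes b\<close> by (cases a; cases b) auto
  next
    case False
    then show ?thesis using *[of a] *[of b] eq \<open>nodes a = nodes b\<close> by simp
  qed
qed

text \<open>Each step changes the shift by -1 modulo \<open>2 * n + 1\<close>, so a shift recurs
  only after \<open>2 * n + 1\<close> steps. This also separates iterates that start from different
  words.\<close>

lemma snd_funpow_step_neq: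
  assumes "i < 2 * n + 1" "j < k" "k < j + (2 * n + 1)"
  shows "snd ((step n ^^ j) (t, i)) \<noteq> snd ((step n ^^ k) (t', i))"
proof
  assume "snd ((step n ^^ j) (t, i)) = snd ((step n ^^ k) (t', i))"
  then have "(i + 2 * n * k) mod (2 * n + 1) = (i + 2 * n * j) mod (2 * n + 1)"
    by (simp only: funpow_step[OF assms(1)] snd_conv)
  moreover have "i + 2 * n * j \<le> i + 2 * n * k" using assms(2) by simp
  ultimately have "(2 * n + 1) dvd i + 2 * n * k - (i + 2 * n * j)"
    by (simp only: mod_eq_dvd_iff_nat)
  also have "i + 2 * n * k - (i + 2 * n * j) = 2 * n * (k - j)" by (simp add: diff_mult_distrib2)
  finally have "(2 * n + 1) dvd 2 * n * (k - j)" .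
  moreover have "(2 * n + 1) dvd 2 * n * (k - j) + (k - j)"
    by (metis add_mult_distrib dvd_triv_left mult_1)
  ultimately have "(2 * n + 1) dvd k - j" by (simp only: dvd_add_right_iff)
  then have "2 * n + 1 \<le> k - j" using assms(2) by (intro dvd_imp_le) auto
  then show False using assms by linarith
qed

lemma step_neq:
  assumes "s \<in> index n" "n \<ge> 1" shows "step n s \<noteq> s"
  using snd_funpow_step_neq[of "snd s" n 0 1 "fst s" "fst s"] assms by (auto simp: index_def)

lemma step_pair_neq_rung:
  assumes "s \<in> index n" "w \<in> index n" "n \<ge> 1"
  shows "step_pair n w \<noteq> {vert True s, vert False s}"
proof
  assume "step_pair n w = {vert True s, vert False s}"
  then have "{vert False s, vert True s} = step_pair n w" by blast
  then have "w = s" "s = step n w" using eq_step_pair[OF assms(1,1,2)] by blast+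
  then show False using step_neq[OF assms(2,3)] by metis
qed

lemma step_pair_eq_iff:
  assumes "r \<in> index n" "w \<in> index n"
  shows "step_pair n w = step_pair n r \<longleftrightarrow> w = r"
  using eq_step_pair[OF assms(1) step_in_index[OF assms(1)] assms(2)] step_pair_def[of n r] by metis

lemma step_pair_in_ladder_iff:
  assumes "successively (\<lambda>r s. s = step n r) ss" "set ss \<subseteq> index n" "n \<ge> 1" "w \<in> index n"
  shows "step_pair n w \<in> path_edges (ladder ss) \<longleftrightarrow> w \<in> set (butlast ss)"
proof -
  have "step_pair n w \<noteq> {vert True s, vert False s}" if "s \<in> index n" for s
    using step_pair_neq_rung[OF that assms(4,3)] .
  moreover have "s = w" if "step_pair n w = step_pair n s" "s \<in> index n" for s
    using step_pair_eq_iff[OF that(2) assms(4)] that(1) by blast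
  ultimately show ?thesis
    using assms(2) unfolding path_edges_ladder[OF assms(1)] by (blast dest: in_set_butlastD)
qed

lemma ladder_edges:
  assumes "successively (\<lambda>r s. s = step n r) ss" "set ss \<subseteq> index n" "n \<ge> 1"
  shows "path_edges (ladder ss) \<subseteq> middle_layer_edges n"
  using assms spoke_edge step_edge unfolding path_edges_ladder[OF assms(1)] step_pair_def
  by (auto simp: insert_commute dest: in_set_butlastD)

lemma set_butlast_distinct: "distinct xs \<Longrightarrow> xs \<noteq> [] \<Longrightarrow> set (butlast xs) = set xs - {last xs}"
  by (cases xs rule: rev_cases) auto

definition region_verts :: "nat \<Rightarrow> dyck \<Rightarrow> bool list set" where
  "region_verts n t = vert False ` region n t \<union> vert True ` region n t"

lemma orbit_cycle:
  assumes "nodes t = n" "n \<ge> 1"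
  obtains xs where "distinct xs" "3 \<le> length xs" "set xs = region_verts n t"
    "closed_walk_edges xs \<subseteq> middle_layer_edges n"
    "\<forall>w\<in>index n. step_pair n w \<in> closed_walk_edges xs \<longleftrightarrow> w \<in> region n t"
proof -
  have t: "(t, 0) \<in> index n" using assms by (simp add: index_def)
  obtain ss where ss: "distinct ss" "ss \<noteq> []" "set ss = region n t" "hd ss = step n (t, 0)"
    "last ss = (t, 0)" "successively (\<lambda>r s. s = step n r) ss"
    by (rule ex_orbit_list[OF t])
  have sub: "set ss \<subseteq> index n" using ss(3) region_subset_index[OF assms(1)] by simp
  have cl: "closed_walk_edges (ladder ss) = insert (step_pair n (t, 0)) (path_edges (ladder ss))"
    using ss(2,4,5) by (simp add: closed_walk_edges_conv_path hd_ladder last_ladder step_pair_def)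
  show ?thesis
  proof (rule that[of "ladder ss"])
    show "distinct (ladder ss)" by (rule distinct_ladder[OF ss(1) sub])
    show "set (ladder ss) = region_verts n t"
      by (simp add: set_ladder ss(3) region_verts_def)
    have "length ss = card (region n t)" using ss(1,3) by (metis distinct_card)
    moreover have "card {(t, 0::nat), (t, 1)} \<le> card (region n t)"
    proof (rule card_mono)
      show "finite (region n t)" using ss(3) by (metis finite_set)
    qed (use assms(2) in \<open>auto simp: region_def\<close>)
    moreover have "length (ladder ss) = 2 * length ss" by (induction ss) auto
    ultimately show "3 \<le> length (ladder ss)" by simp
    show "closed_walk_edges (ladder ss) \<subseteq> middle_layer_edges n"
      using ladder_edges[OF ss(6) sub assms(2)] step_edge[OF t assms(2)]
      unfolding cl step_pair_def by simp
  next
    show "\<forall>w\<in>index n. step_pair n w \<in> closed_walk_edges (ladder ss) \<longleftrightarrow> w \<in> region n t"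
    proof
      fix w assume w: "w \<in> index n"
      have "step_pair n w = step_pair n (t, 0) \<longleftrightarrow> w = (t, 0)"
        by (rule step_pair_eq_iff[OF t w])
      moreover have "set (butlast ss) = region n t - {(t, 0)}"
        using set_butlast_distinct[OF ss(1,2)] ss(3,5) by simp
      moreover have "(t, 0) \<in> region n t" by (simp add: region_def)
      ultimately show "step_pair n w \<in> closed_walk_edges (ladder ss) \<longleftrightarrow> w \<in> region n t"
        using step_pair_in_ladder_iff[OF ss(6) sub assms(2) w] unfolding cl by blast
    qed
  qed
qed

text \<open>Removing the step edge at \<open>(t, i)\<close> and the spoke at its \<open>k\<close>-th
  iterate leaves two paths. For \<open>k = 3\<close> these are the two edges that a 6-cycle shares
  with the cycle of the pulled word.\<close>

lemma orbit_two_paths: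
  assumes "nodes t = n" "n \<ge> 1" "i < 2 * n + 1"
  obtains p q where "p \<noteq> []" "q \<noteq> []" "distinct (p @ q)" "set (p @ q) = region_verts n t"
    "hd p = vert True (step n (t, i))" "last p = vert True ((step n ^^ k) (t, i))"
    "hd q = vert False ((step n ^^ k) (t, i))" "last q = vert False (t, i)"
    "path_edges p \<union> path_edges q \<subseteq> middle_layer_edges n"
    "\<forall>w\<in>index n. step_pair n w \<in> path_edges p \<union> path_edges q \<longleftrightarrow> w \<in> region n t - {(t, i)}"
proof -
  have t: "(t, i) \<in> index n" using assms by (simp add: index_def)
  let ?z = "(step n ^^ k) (t, i)"
  obtain ss where ss: "distinct ss" "ss \<noteq> []" "set ss = region n t" "hd ss = step n (t, i)"
    "last ss = (t, i)" "successively (\<lambda>r s. s = step n r) ss"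
    by (rule ex_orbit_list[OF t])
  have sub: "set ss \<subseteq> index n" using ss(3) region_subset_index[OF assms(1)] by simp
  have "?z \<in> set ss" using orbit_step[OF t] ss(3) unfolding region_def by blast
  then obtain a b where ab: "ss = a @ ?z # b" by (meson split_list)
  let ?p = "ladder a @ [vert True ?z]" and ?q = "vert False ?z # ladder b"
  have pq: "ladder ss = ?p @ ?q" by (subst ab) simp
  have e: "path_edges (ladder ss) = insert {vert True ?z, vert False ?z} (path_edges ?p \<union> path_edges ?q)"
    unfolding pq by (subst path_edges_append) auto
  have z: "?z \<in> index n" using t by auto
  show ?thesis
  proof (rule that[of ?p ?q])
    show "distinct (?p @ ?q)" using distinct_ladder[OF ss(1) sub] by (simp only: pq)
    have "set (ladder ss) = region_verts n t"
      by (simp add: set_ladder ss(3) region_verts_def)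
    then show "set (?p @ ?q) = region_verts n t" by (simp only: pq)
    have "hd ?p = hd (?p @ ?q)" by (simp add: hd_append)
    also have "\<dots> = vert True (hd ss)" using hd_ladder[OF ss(2)] by (simp only: pq)
    finally show "hd ?p = vert True (step n (t, i))" using ss(4) by simp
    have "last ?q = last (?p @ ?q)" by simp
    also have "\<dots> = vert False (last ss)" using last_ladder[OF ss(2)] by (simp only: pq)
    finally show "last ?q = vert False (t, i)" using ss(5) by simp
    show "path_edges ?p \<union> path_edges ?q \<subseteq> middle_layer_edges n"
      using ladder_edges[OF ss(6) sub assms(2)] unfolding e by blast
  next
    show "\<forall>w\<in>index n. step_pair n w \<in> path_edges ?p \<union> path_edges ?q \<longleftrightarrow> w \<in> region n t - {(t, i)}"
    proof
      fix w assume w: "w \<in> index n"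
      have "step_pair n w \<noteq> {vert True ?z, vert False ?z}"
        by (rule step_pair_neq_rung[OF z w assms(2)])
      then have "step_pair n w \<in> path_edges ?p \<union> path_edges ?q \<longleftrightarrow> step_pair n w \<in> path_edges (ladder ss)"
        unfolding e by blast
      also have "\<dots> \<longleftrightarrow> w \<in> set (butlast ss)"
        by (rule step_pair_in_ladder_iff[OF ss(6) sub assms(2) w])
      also have "set (butlast ss) = region n t - {(t, i)}"
        using set_butlast_distinct[OF ss(1,2)] ss(3,5) by simp
      finally show "step_pair n w \<in> path_edges ?p \<union> path_edges ?q \<longleftrightarrow> w \<in> region n t - {(t, i)}" .
    qed
  qed auto
qed

lemma region_disjoint: "cls s \<noteq> cls t \<Longrightarrow> region n s \<inter> region n t = {}"
  unfolding region_def by (auto dest: cls_eqI)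

lemma region_verts_disjoint:
  assumes "cls s \<noteq> cls t" "nodes s = n" "nodes t = n"
  shows "region_verts n s \<inter> region_verts n t = {}"
proof -
  have "vert c ` region n s \<inter> vert d ` region n t = {}" for c d
  proof (cases "c = d")
    case True
    then show ?thesis
      using inj_on_image_Int[OF vert_inj region_subset_index[OF assms(2)] region_subset_index[OF assms(3)]]
        region_disjoint[OF assms(1)] by simp
  next
    case False
    then have "d = (\<not> c)" by blast
    then show ?thesis
      using vert_disjoint[of c n] region_subset_index[OF assms(2)] region_subset_index[OF assms(3)] by blast
  qed
  then show ?thesis unfolding region_verts_def by blast
qed

section \<open>Joining one tree after another\<close>

definition pullable :: "dyck \<Rightarrow> bool" where
  "pullable x \<longleftrightarrow> (\<exists>u v. x = Nd (Nd Emp u) v)"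

lemma nodes_pull [simp]: "nodes (pull x) = nodes x"
  by (cases x rule: pull.cases) auto

text \<open>Together with \<open>pull_inj\<close> this keeps the step edges removed by different
  pulls apart.\<close>

lemma not_pullable_pull: "pullable x \<Longrightarrow> \<not> pullable (pull x)"
  by (auto simp: pullable_def)

lemma pull_inj: "pullable x \<Longrightarrow> pullable y \<Longrightarrow> pull x = pull y \<Longrightarrow> x = y"
  by (auto simp: pullable_def)

text \<open>The last clause says which of the \<^const>\<open>step_pair\<close> edges survive. It guarantees that the edge
  needed for the next 6-cycle is still there, and it recovers the shifts \<open>sh\<close> from the edge set.\<close>

definition merged_cycle :: "nat \<Rightarrow> dyck \<Rightarrow> (dyck \<Rightarrow> nat) \<Rightarrow> dyck set \<Rightarrow> bool list list \<Rightarrow> bool" where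
  "merged_cycle n r sh S xs \<longleftrightarrow> distinct xs \<and> 3 \<le> length xs \<and>
     set xs = (\<Union>t\<in>insert r S. region_verts n t) \<and>
     closed_walk_edges xs \<subseteq> middle_layer_edges n \<and>
     (\<forall>w\<in>index n. step_pair n w \<in> closed_walk_edges xs \<longleftrightarrow>
        w \<in> (\<Union>t\<in>insert r S. region n t) - (\<Union>x\<in>S. {(x, sh x), (pull x, sh x)}))"

text \<open>The old cycle is opened at the step edge of \<open>pull x\<close>, the cycle of
  \<open>x\<close> at its step edge and at the spoke three steps on; the rest of the 6-cycle joins
  the pieces. By \<open>new\<close>, the cycle of \<open>x\<close> is still disjoint from the old
  one.\<close>

lemma merged_cycle_insert:
  assumes xs: "merged_cycle n r sh S xs" and n: "n \<ge> 1"
    and nodes: "\<And>t. t \<in> insert r (insert x S) \<Longrightarrow> nodes t = n"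
    and pullable: "\<And>t. t \<in> insert x S \<Longrightarrow> pullable t"
    and sh: "sh x < 2 * n + 1"
    and parents: "\<And>t. t \<in> insert x S \<Longrightarrow> \<exists>s\<in>insert r S. pull t \<in> cls s"
    and new: "\<And>t. t \<in> insert r S \<Longrightarrow> cls t \<noteq> cls x"
  shows "\<exists>ys. merged_cycle n r sh (insert x S) ys"
proof -
  have xs_cycle: "distinct xs" "3 \<le> length xs"
    and set_xs: "set xs = (\<Union>t\<in>insert r S. region_verts n t)"
    and xs_edges: "closed_walk_edges xs \<subseteq> middle_layer_edges n"
    and xs_iff: "\<forall>w\<in>index n. step_pair n w \<in> closed_walk_edges xs \<longleftrightarrow>
      w \<in> (\<Union>t\<in>insert r S. region n t) - (\<Union>x\<in>S. {(x, sh x), (pull x, sh x)})"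
    using xs unfolding merged_cycle_def by blast+
  let ?i = "sh x" let ?f = "step n" let ?y = "pull x"
  let ?z = "(?f ^^ 3) (x, ?i)"
  have x: "nodes x = n" using nodes by simp
  obtain u v where uv: "x = Nd (Nd Emp u) v" using pullable[of x] by (auto simp: pullable_def)
  have n2: "n \<ge> 2" using x by (simp add: uv)
  have X: "(x, ?i) \<in> index n" and Y: "(?y, ?i) \<in> index n" using x sh by (auto simp: index_def)
  have Z: "?z \<in> index n" using X by auto
  have xS: "x \<notin> insert r S" using new by blast
  have YS: "(?y, ?i) \<in> (\<Union>t\<in>insert r S. region n t)"
    using parents[of x] sh by (auto simp: region_def)
  \<comment> \<open>The step edge of \<open>pull x\<close> has not been removed:
    \<open>pull x\<close> is not pullable, hence not in \<open>S\<close>, and by injectivity it is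
    not the pull of a member of \<open>S\<close>.\<close>
  have "(?y, ?i) \<noteq> (t, sh t)" "(?y, ?i) \<noteq> (pull t, sh t)" if "t \<in> S" for t
    using that pullable[of x] pullable[of t] not_pullable_pull[of x] pull_inj[of x t] xS by auto
  then have "step_pair n (?y, ?i) \<in> closed_walk_edges xs"
    using xs_iff Y YS by blast
  then have e: "{vert False (?y, ?i), vert True (?f (?y, ?i))} \<in> closed_walk_edges xs"
    by (simp add: step_pair_def)
  obtain p q where pq: "p \<noteq> []" "q \<noteq> []" "distinct (p @ q)" "set (p @ q) = region_verts n x"
    "hd p = vert True (?f (x, ?i))" "last p = vert True ?z"
    "hd q = vert False ?z" "last q = vert False (x, ?i)"
    "path_edges p \<union> path_edges q \<subseteq> middle_layer_edges n"
    "\<forall>w\<in>index n. step_pair n w \<in> path_edges p \<union> path_edges q \<longleftrightarrow> w \<in> region n x - {(x, ?i)}"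
    by (rule orbit_two_paths[OF x n sh, of 3])
  have "region_verts n t \<inter> region_verts n x = {}" if "t \<in> insert r S" for t
    using region_verts_disjoint[OF new[OF that]] nodes that by blast
  then have disj: "set xs \<inter> set (p @ q) = {}"
    unfolding set_xs pq(4) by blast
  obtain ys where ys: "distinct ys" "3 \<le> length ys" "set ys = set xs \<union> set (p @ q)"
    "closed_walk_edges ys = (closed_walk_edges xs - {{vert False (?y, ?i), vert True (?f (?y, ?i))}})
      \<union> path_edges p \<union> path_edges q \<union>
      {{last p, vert False (?y, ?i)}, {vert True (?f (?y, ?i)), last q}, {hd q, hd p}}"
    by (rule closed_walk_glue[OF xs_cycle e pq(1-3) disj])
  let ?new = "{{vert False (?y, ?i), vert True ?z}, {vert False (x, ?i), vert True (?f (?y, ?i))},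
    {vert False ?z, vert True (?f (x, ?i))}}"
  have edges: "closed_walk_edges ys = (closed_walk_edges xs - {step_pair n (?y, ?i)})
    \<union> (path_edges p \<union> path_edges q) \<union> ?new"
    unfolding ys(4) pq(5-8) step_pair_def by (simp add: insert_commute Un_assoc)
  have new_edges: "?new \<subseteq> middle_layer_edges n"
    using hexagon_edges[OF uv x sh] by (simp add: insert_commute)
  \<comment> \<open>The first and third new edge fail to be step edges because the shifts disagree.
    In the second the shifts agree, but \<open>x\<close> and \<open>pull x\<close> have different
    turns.\<close>
  have not_new: "step_pair n w \<notin> ?new" if w: "w \<in> index n" for w
  proof -
    have "?f (?y, ?i) \<noteq> ?z"
      using snd_funpow_step_neq[OF sh, of 1 3 ?y x] n by auto
    then have "{vert False (?y, ?i), vert True ?z} \<noteq> step_pair n w"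
      unfolding eq_step_pair[OF Y Z w] by metis
    moreover have "?f (x, ?i) \<noteq> ?f (?y, ?i)"
      using pullable[of x] not_pullable_pull[of x] by (auto simp: step_def dest: turn_inj)
    then have "{vert False (x, ?i), vert True (?f (?y, ?i))} \<noteq> step_pair n w"
      unfolding eq_step_pair[OF X step_in_index[OF Y] w] by metis
    moreover have "?f ?z \<noteq> ?f (x, ?i)"
      using snd_funpow_step_neq[OF sh, of 1 4 x x] n2 by (auto simp: numeral_eq_Suc)
    then have "{vert False ?z, vert True (?f (x, ?i))} \<noteq> step_pair n w"
      unfolding eq_step_pair[OF Z step_in_index[OF X] w] by metis
    ultimately show ?thesis by blast
  qed
  have iff: "step_pair n w \<in> closed_walk_edges ys \<longleftrightarrow>
      step_pair n w \<in> closed_walk_edges xs \<and> w \<noteq> (?y, ?i) \<or> w \<in> region n x - {(x, ?i)}"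
    if w: "w \<in> index n" for w
  proof -
    have "step_pair n w \<in> closed_walk_edges ys \<longleftrightarrow>
      step_pair n w \<in> closed_walk_edges xs - {step_pair n (?y, ?i)} \<or>
      step_pair n w \<in> path_edges p \<union> path_edges q"
      unfolding edges Un_iff[of _ _ ?new] Un_iff[of _ "_ - _"] using not_new[OF w] by simp
    also have "step_pair n w \<in> path_edges p \<union> path_edges q \<longleftrightarrow> w \<in> region n x - {(x, ?i)}"
      using pq(10) w by (rule bspec)
    also have "step_pair n w \<in> closed_walk_edges xs - {step_pair n (?y, ?i)} \<longleftrightarrow>
      step_pair n w \<in> closed_walk_edges xs \<and> w \<noteq> (?y, ?i)"
      using step_pair_eq_iff[OF Y w] by simp
    finally show ?thesis .
  qed
  let ?R = "\<Union>t\<in>insert r S. region n t"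
  let ?D = "\<Union>t\<in>S. {(t, sh t), (pull t, sh t)}"
  have "?R \<inter> region n x = {}"
    using new region_disjoint by blast
  \<comment> \<open>Earlier pulls start and end in old classes, so they removed nothing from the
    region of \<open>x\<close>.\<close>
  have D: "w \<notin> ?D" if "w \<in> region n x" for w
  proof
    assume "w \<in> ?D"
    then obtain t where t: "t \<in> S" "fst w = t \<or> fst w = pull t" by auto
    from t(2) have "\<exists>s\<in>insert r S. fst w \<in> cls s"
    proof
      assume "fst w = t"
      then show ?thesis using t(1) by (intro bexI[of _ t]) simp_all
    next
      assume "fst w = pull t"
      then show ?thesis using parents[of t] t(1) by simp
    qed
    moreover have "fst w \<in> cls x" using that by (auto simp: region_def)
    ultimately show False using new cls_eqI by metis
  qed
  have "(x, ?i) \<in> region n x" using sh by (simp add: region_def)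
  then have sets: "w \<in> (?R - ?D) - {(?y, ?i)} \<union> (region n x - {(x, ?i)}) \<longleftrightarrow>
      w \<in> (?R \<union> region n x) - ({(x, ?i), (?y, ?i)} \<union> ?D)" for w
    using \<open>?R \<inter> _ = {}\<close> D YS by blast
  have "merged_cycle n r sh (insert x S) ys"
    unfolding merged_cycle_def
  proof (intro conjI ballI)
    show "set ys = (\<Union>t\<in>insert r (insert x S). region_verts n t)"
      unfolding ys(3) set_xs pq(4) by blast
    show "closed_walk_edges ys \<subseteq> middle_layer_edges n"
      using xs_edges pq(9) new_edges unfolding edges by blast
    fix w assume w: "w \<in> index n"
    have "step_pair n w \<in> closed_walk_edges xs \<longleftrightarrow> w \<in> ?R - ?D"
      using xs_iff w by blast
    then have "step_pair n w \<in> closed_walk_edges ys \<longleftrightarrow>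
        w \<in> (?R - ?D) - {(?y, ?i)} \<union> (region n x - {(x, ?i)})"
      using iff[OF w] by blast
    also have "\<dots> \<longleftrightarrow> w \<in> (?R \<union> region n x) - ({(x, ?i), (?y, ?i)} \<union> ?D)"
      by (rule sets)
    also have "?R \<union> region n x = (\<Union>t\<in>insert r (insert x S). region n t)" by blast
    also have "{(x, ?i), (?y, ?i)} \<union> ?D = (\<Union>t\<in>insert x S. {(t, sh t), (pull t, sh t)})" by blast
    finally show "step_pair n w \<in> closed_walk_edges ys \<longleftrightarrow>
        w \<in> (\<Union>t\<in>insert r (insert x S). region n t) - (\<Union>t\<in>insert x S. {(t, sh t), (pull t, sh t)})" .
  qed (use ys in auto)
  then show ?thesis ..
qed

text \<open>Trees are added in order of increasing potential. A pull lowers the potential, so its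
  target cannot lie in the class of the tree added last and has been joined already.\<close>

lemma ex_merged_cycle:
  assumes "finite S" "n \<ge> 1" "nodes r = n" "\<not> pullable r"
    and "\<And>t. t \<in> S \<Longrightarrow> nodes t = n \<and> pullable t \<and> sh t < 2 * n + 1"
    and "\<And>t. t \<in> S \<Longrightarrow> potential (pull t) < potential t"
    and "\<And>t. t \<in> S \<Longrightarrow> \<exists>s\<in>insert r S. pull t \<in> cls s"
    and "inj_on cls (insert r S)"
  shows "\<exists>xs. merged_cycle n r sh S xs"
  using assms
proof (induction S rule: finite_ranking_induct[where f = potential])
  case empty
  obtain xs where "distinct xs" "3 \<le> length xs" "set xs = region_verts n r"
    "closed_walk_edges xs \<subseteq> middle_layer_edges n"
    "\<forall>w\<in>index n. step_pair n w \<in> closed_walk_edges xs \<longleftrightarrow> w \<in> region n r"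
    by (rule orbit_cycle[OF empty(2,1)])
  then have "merged_cycle n r sh {} xs" unfolding merged_cycle_def by simp
  then show ?case ..
next
  case (insert x S)
  show ?case
  proof (cases "x \<in> S")
    case True
    then have "insert x S = S" by blast
    then show ?thesis using insert.IH insert.prems by simp
  next
    case False
    have parents: "\<exists>s\<in>insert r S. pull t \<in> cls s" if t: "t \<in> insert x S" for t
    proof -
      obtain s where s: "s \<in> insert r (insert x S)" "pull t \<in> cls s"
        using insert.prems(6)[OF t] by blast
      have "s \<noteq> x"
      proof
        assume "s = x"
        then have "potential x < potential t"
          using insert.prems(5)[OF t] potential_cls[OF s(2)] by simp
        moreover have "potential t \<le> potential x"
          using t insert.hyps(2) by auto
        ultimately show False by simp
      qed
      then show ?thesis using s by blast
    qed
    have "\<exists>xs. merged_cycle n r sh S xs"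
    proof (rule insert.IH[OF insert.prems(1-3)])
      show "inj_on cls (insert r S)"
        using insert.prems(7) by (rule inj_on_subset) blast
    qed (use insert.prems(4,5) parents in auto)
    then obtain xs where "merged_cycle n r sh S xs" ..
    then show ?thesis
    proof (rule merged_cycle_insert)
      fix t assume "t \<in> insert r S"
      moreover have "t \<noteq> x" using \<open>t \<in> insert r S\<close> False insert.prems(3) insert.prems(4)[of x] by auto
      ultimately show "cls t \<noteq> cls x"
        using insert.prems(7) unfolding inj_on_def by blast
    qed (use insert.prems parents in auto)
  qed
qed

section \<open>Counting plane trees\<close>

lemma finite_nodes: "finite {t. nodes t = n}"
proof (rule finite_imageD)
  show "finite (word ` {t. nodes t = n})"
    by (rule finite_subset[OF _ finite_lists_length_eq[of UNIV "2 * n"]]) auto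
  show "inj_on word {t. nodes t = n}" by (rule inj_onI) (rule word_inj)
qed

text \<open>For nonempty words \<open>Nd Emp t\<close> and \<open>Nd t Emp\<close> never coincide,
  so the number of words at least doubles with each node.\<close>

lemma card_nodes_ge: "2 ^ n \<le> card {t. nodes t = Suc n}"
proof (induction n)
  case 0
  have "Nd Emp Emp \<in> {t. nodes t = Suc 0}" by simp
  then have "card {t. nodes t = Suc 0} \<noteq> 0" using finite_nodes[of "Suc 0"] by (metis card_0_eq empty_iff)
  then show ?case by simp
next
  case (Suc n)
  let ?T = "{t. nodes t = Suc n}"
  have "Nd Emp ` ?T \<inter> (\<lambda>t. Nd t Emp) ` ?T = {}" by auto
  then have "card (Nd Emp ` ?T \<union> (\<lambda>t. Nd t Emp) ` ?T) = card (Nd Emp ` ?T) + card ((\<lambda>t. Nd t Emp) ` ?T)"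
    using finite_nodes by (intro card_Un_disjoint) auto
  also have "card (Nd Emp ` ?T) = card ?T" by (intro card_image inj_onI) simp
  also have "card ((\<lambda>t. Nd t Emp) ` ?T) = card ?T" by (intro card_image inj_onI) simp
  finally have "2 * card ?T = card (Nd Emp ` ?T \<union> (\<lambda>t. Nd t Emp) ` ?T)" by simp
  also have "\<dots> \<le> card {t. nodes t = Suc (Suc n)}"
    using finite_nodes by (intro card_mono) auto
  finally show ?case using Suc.IH by simp
qed

text \<open>Turning has a period dividing \<open>2 * n\<close>, so no class has more than
  \<open>2 * n\<close> words.\<close>

lemma card_classes_ge:
  assumes "n \<ge> 1"
  shows "2 ^ (n - 1) \<le> 2 * n * card (cls ` {t. nodes t = n})"
proof -
  let ?C = "cls ` {t. nodes t = n}"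
  have "card C \<le> 2 * n \<and> finite C" if C: "C \<in> ?C" for C
  proof -
    obtain t where t: "C = cls t" "nodes t = n" using C by blast
    have "C \<subseteq> (\<lambda>k. (turn ^^ k) t) ` {..<2 * n}"
      using cls_subset_bounded[OF t(2) assms] t(1) by simp
    then show ?thesis
      using surj_card_le[of "{..<2 * n}" C] by (auto intro: finite_subset)
  qed
  then have "card (\<Union>C\<in>?C. C) \<le> (\<Sum>C\<in>?C. 2 * n)"
    using finite_nodes by (intro order_trans[OF card_UN_le sum_mono]) auto
  moreover have "card {t. nodes t = n} \<le> card (\<Union>C\<in>?C. C)"
  proof (rule card_mono)
    show "finite (\<Union>C\<in>?C. C)" using finite_nodes \<open>\<And>C. C \<in> ?C \<Longrightarrow> _\<close> by blast
  qed (use self_in_cls in blast)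
  moreover have "2 ^ (n - 1) \<le> card {t. nodes t = n}"
    using card_nodes_ge[of "n - 1"] assms by simp
  ultimately show ?thesis by (simp add: mult.commute)
qed

text \<open>Induction in steps of four from 7, 8, 9 and 10: the left side grows by a factor of at
  most 4, the right side by 16.\<close>

lemma two_power_bound: "7 \<le> n \<Longrightarrow> 2 * n * 2 ^ ((n + 1) div 4) \<le> (2 :: nat) ^ (n - 1)"
proof (induction n rule: less_induct)
  case (less n)
  show ?case
  proof (cases "n < 11")
    case True
    then have "n = 7 \<or> n = 8 \<or> n = 9 \<or> n = 10" using less.prems by linarith
    then show ?thesis by auto
  next
    case False
    define m where "m = n - 4"
    have m: "n = m + 4" "7 \<le> m" using False by (simp_all add: m_def)
    have "2 * n * 2 ^ ((n + 1) div 4) = 2 * (m + 4) * 2 * 2 ^ ((m + 1) div 4)"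
    proof -
      have "(n + 1) div 4 = Suc ((m + 1) div 4)" unfolding m(1) by simp
      then show ?thesis unfolding m(1) by (simp add: mult_ac)
    qed
    also have "\<dots> \<le> 4 * (2 * m * 2 ^ ((m + 1) div 4))"
      using m(2) by simp
    also have "\<dots> \<le> 4 * 2 ^ (m - 1)"
      using less.IH[of m] m by simp
    also have "\<dots> \<le> 16 * 2 ^ (m - 1)" by simp
    also have "\<dots> = 2 ^ (4 + (m - 1))" by (simp only: power_add) simp
    also have "4 + (m - 1) = n - 1" using m by simp
    finally show ?thesis .
  qed
qed

text \<open>Below 7 the power is at most 2, and a single class suffices because of the added
  1.\<close>

lemma card_classes_ge':
  assumes "n \<ge> 1"
  shows "2 ^ ((n + 1) div 4) \<le> card (cls ` {t. nodes t = n}) + 1"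
proof (cases "7 \<le> n")
  case True
  then have "2 * n * 2 ^ ((n + 1) div 4) \<le> 2 * n * card (cls ` {t. nodes t = n})"
    using two_power_bound[OF True] card_classes_ge[OF assms] by linarith
  then show ?thesis using assms by simp
next
  case False
  have "card (cls ` {t. nodes t = n}) \<noteq> 0"
    using finite_nodes[of n] nodes_star[of n] by (auto simp del: nodes_star)
  moreover have "(n + 1) div 4 \<le> 1" using False by linarith
  then have "(2 :: nat) ^ ((n + 1) div 4) \<le> 2 ^ 1" by (intro power_increasing) auto
  ultimately show ?thesis by simp
qed

text \<open>From each class other than that of the star, pick a word whose pull lowers the
  potential. The star has no such word and becomes the root of the joining process.\<close>

lemma ex_representatives:
  obtains R where "finite R" "\<And>t. t \<in> R \<Longrightarrow> nodes t = n \<and> pullable t"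
    "\<And>t. t \<in> R \<Longrightarrow> potential (pull t) < potential t"
    "cls ` insert (star n) R = cls ` {t. nodes t = n}"
    "inj_on cls (insert (star n) R)"
    "card (cls ` {t. nodes t = n}) = card R + 1"
proof -
  let ?C = "cls ` {t. nodes t = n} - {cls (star n)}"
  have "\<exists>x. cls x = C \<and> nodes x = n \<and> pullable x \<and> potential (pull x) < potential x" if C: "C \<in> ?C" for C
  proof -
    obtain t where t: "C = cls t" "nodes t = n" "cls t \<noteq> cls (star (nodes t))" using C by auto
    obtain u v where uv: "Nd (Nd Emp u) v \<in> cls t" "potential (Nd Emp (Nd u v)) < potential t"
      using ex_descending_pull[OF t(3)] by blast
    show ?thesis
      using t uv cls_eqI[OF uv(1)] nodes_cls[OF uv(1)] potential_cls[OF uv(1)]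
      by (intro exI[of _ "Nd (Nd Emp u) v"]) (auto simp: pullable_def)
  qed
  then have "\<exists>rep. \<forall>C\<in>?C. cls (rep C) = C \<and> nodes (rep C) = n \<and> pullable (rep C) \<and>
      potential (pull (rep C)) < potential (rep C)"
    by (intro bchoice) blast
  then obtain rep where rep: "cls (rep C) = C" "nodes (rep C) = n" "pullable (rep C)"
    "potential (pull (rep C)) < potential (rep C)" if "C \<in> ?C" for C
    by blast
  have cls_R: "cls ` rep ` ?C = ?C" using rep(1) by (force simp: image_image)
  have "inj_on cls (rep ` ?C)"
  proof (intro inj_on_imageI inj_onI)
    fix A B assume "A \<in> ?C" "B \<in> ?C" "(cls \<circ> rep) A = (cls \<circ> rep) B"
    then show "A = B" using rep(1)[of A] rep(1)[of B] by (simp only: comp_apply)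
  qed
  moreover have "cls (star n) \<notin> cls ` rep ` ?C" unfolding cls_R by simp
  ultimately have inj: "inj_on cls (insert (star n) (rep ` ?C))"
    by (auto simp: inj_on_insert)
  have fin: "finite (rep ` ?C)" using finite_nodes by simp
  have im: "cls ` insert (star n) (rep ` ?C) = cls ` {t. nodes t = n}"
    unfolding image_insert cls_R by auto
  have "star n \<notin> rep ` ?C" using \<open>cls (star n) \<notin> _\<close> by blast
  then have "card (cls ` {t. nodes t = n}) = card (rep ` ?C) + 1"
    using card_image[OF inj] fin unfolding im by simp
  then show ?thesis using that[OF fin _ _ im inj] rep(2-4) by blast
qed

section \<open>Counting the Hamilton cycles\<close>

lemma not_pullable_star: "\<not> pullable (star n)"
  by (cases n) (auto simp: pullable_def)

theorem theorem2:
  fixes n :: nat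
  assumes "n \<ge> 1"
  shows "real (card {C. hamilton_cycle (middle_layer_verts n) (middle_layer_edges n) C})
           \<ge> 1 / 4 * 2 ^ (2 ^ ((n + 1) div 4))"
proof -
  let ?H = "{C. hamilton_cycle (middle_layer_verts n) (middle_layer_edges n) C}"
  obtain R where R: "finite R" "\<And>t. t \<in> R \<Longrightarrow> nodes t = n \<and> pullable t"
    "\<And>t. t \<in> R \<Longrightarrow> potential (pull t) < potential t"
    "cls ` insert (star n) R = cls ` {t. nodes t = n}" "inj_on cls (insert (star n) R)"
    "card (cls ` {t. nodes t = n}) = card R + 1"
    using ex_representatives[of n] by metis
  have covered: "\<exists>s\<in>insert (star n) R. t \<in> cls s" if "nodes t = n" for t
  proof -
    have "cls t \<in> cls ` insert (star n) R" unfolding R(4) using that by blast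
    then obtain s where "s \<in> insert (star n) R" "cls t = cls s" by blast
    then show ?thesis using self_in_cls[of t] by auto
  qed
  \<comment> \<open>A subset \<open>D\<close> of the representatives encodes one binary choice per
    tree: the 6-cycle with shift 1 for its members, with shift 0 for the others.\<close>
  define sh :: "dyck set \<Rightarrow> dyck \<Rightarrow> nat" where "sh D x = (if x \<in> D then 1 else 0)" for D x
  have "\<exists>xs. merged_cycle n (star n) (sh D) R xs" for D
  proof (rule ex_merged_cycle)
    fix t assume t: "t \<in> R"
    then show "\<exists>s\<in>insert (star n) R. pull t \<in> cls s" using R(2) by (intro covered) simp
    show "nodes t = n \<and> pullable t \<and> sh D t < 2 * n + 1"
      using R(2)[OF t] assms by (simp add: sh_def)
  qed (use assms R not_pullable_star in auto)
  then obtain cyc where cyc: "merged_cycle n (star n) (sh D) R (cyc D)" for D by metis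
  have regions: "(\<Union>t\<in>insert (star n) R. region n t) = index n"
    using covered R(2) by (fastforce simp: region_def index_def dest: nodes_cls)
  have verts: "(\<Union>t\<in>insert (star n) R. region_verts n t) = middle_layer_verts n"
    unfolding middle_layer_verts_eq region_verts_def UN_Un_distrib
    by (simp only: regions flip: image_UN)
  have "hamilton_cycle (middle_layer_verts n) (middle_layer_edges n) (closed_walk_edges (cyc D))" for D
    using cyc[of D] unfolding merged_cycle_def verts hamilton_cycle_def by blast
  then have sub: "(\<lambda>D. closed_walk_edges (cyc D)) ` Pow R \<subseteq> ?H" by blast
  \<comment> \<open>The Hamilton cycle determines \<open>D\<close>: the step edge at
    \<open>(x, 0)\<close> is missing exactly when \<open>x\<close> was pulled with shift 0, since no
    other pull can remove it.\<close>
  have "step_pair n (x, 0) \<in> closed_walk_edges (cyc D) \<longleftrightarrow> x \<in> D" if x: "x \<in> R" for x D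
  proof -
    have "(x, 0) \<in> index n" using R(2)[OF x] by (simp add: index_def)
    then have "step_pair n (x, 0) \<in> closed_walk_edges (cyc D) \<longleftrightarrow>
      (x, 0) \<in> index n - (\<Union>t\<in>R. {(t, sh D t), (pull t, sh D t)})"
      using cyc[of D] unfolding merged_cycle_def regions by blast
    also have "\<dots> \<longleftrightarrow> sh D x \<noteq> 0"
    proof -
      have "x \<noteq> pull t" if "t \<in> R" for t
        using R(2) not_pullable_pull that x by metis
      then show ?thesis using \<open>(x, 0) \<in> index n\<close> x by auto
    qed
    finally show ?thesis by (simp add: sh_def)
  qed
  then have "D = {x \<in> R. step_pair n (x, 0) \<in> closed_walk_edges (cyc D)}" if "D \<subseteq> R" for D
    using that by auto
  then have "inj_on (\<lambda>D. closed_walk_edges (cyc D)) (Pow R)"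
    by (intro inj_onI) (metis PowD)
  then have "card ((\<lambda>D. closed_walk_edges (cyc D)) ` Pow R) = 2 ^ card R"
    using R(1) by (simp add: card_image card_Pow)
  \<comment> \<open>An infinite set would have \<open>card\<close> 0, so finiteness is needed to
    bound \<open>card ?H\<close> from below.\<close>
  moreover have "finite ?H"
  proof (rule finite_subset)
    show "?H \<subseteq> Pow (Pow (middle_layer_verts n))"
      unfolding hamilton_cycle_def middle_layer_edges_def by blast
    have "finite (bitstrings m k)" for m k
      unfolding bitstrings_def
      by (rule finite_subset[OF _ finite_lists_length_eq[of UNIV m]]) auto
    then show "finite (Pow (Pow (middle_layer_verts n)))"
      by (simp add: middle_layer_verts_def)
  qed
  ultimately have "2 ^ card R \<le> card ?H" using card_mono[OF _ sub] by simp
  then have "2 ^ card R \<le> real (card ?H)" by (metis of_nat_le_iff of_nat_numeral of_nat_power)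
  \<comment> \<open>The factor 1/4 covers two missing binary choices: one for the star, which is not
    pulled, and one for the added 1 in the class count.\<close>
  moreover have "(2 :: nat) ^ ((n + 1) div 4) \<le> card R + 2"
    using card_classes_ge'[OF assms] R(6) by simp
  then have "(2 :: real) ^ (2 ^ ((n + 1) div 4)) \<le> 2 ^ (card R + 2)"
    by (intro power_increasing) auto
  then have "(2 :: real) ^ (2 ^ ((n + 1) div 4)) \<le> 4 * 2 ^ card R"
    by (simp only: power_add) simp
  ultimately show ?thesis by linarith
qed

end
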